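(* Let $\mathfrak g$ be a simply laced Kac–Moody algebra with Cartan matrix $\mathbf A$. The $\mathbb C$-algebra morphism $$\Phi_{\mathbf A}\otimes\mathrm{id}:\mathbb C[H_{i,-r}]_{i\in I,r>0}\otimes\mathbb C_\varepsilon[Q]\to\mathbb C[\mathcal H_{i,-r}]_{i\in I,r>0}\otimes\mathbb C_\varepsilon[Q]$$ is a morphism of $\mathfrak t$-modules $\mathcal V_{\mathbf A}\to\mathcal V$. It is an isomorphism precisely when $\mathbf A$ is invertible.
   Context: Setting. $\mathbf A=(a_{ij})_{i,j\in I}$ is indecomposable, symmetric, with $a_{ii}=2$ and $a_{ij}\in\{0,-1\}$ for $i\ne j$. Simple roots $\alpha_i$, root lattice $Q=\bigoplus\mathbb Z\alpha_i$, form normalized by $(\alpha_i,\alpha_i)=2$, $d_{ij}=\frac12(\alpha_i,\alpha_j)$. $\varepsilon:Q\times Q\to\{\pm1\}$ is a fixed bimultiplicative function with $\varepsilon(\alpha,\alpha)=(-1)^{\frac12(\alpha,\alpha)}$ for all $\alpha \in Q$; $\mathbb C_\varepsilon[Q]$ is the algebra with basis $\{e^\alpha\}_{\alpha\in Q}$ and $e^\alpha e^\beta=\varepsilon(\alpha,\beta)e^{\alpha+\beta}$; on a space of the form $F\otimes\mathbb C_\varepsilon[Q]$, $e^\alpha$ acts by left multiplication on the second factor and $z^{\partial_\alpha}(f\otimes e^\beta)=z^{(\alpha,\beta)}f\otimes e^\beta$. $\mathfrak t$ is the Lie algebra generated by $\mathbf C$ and the coefficients of $X_i^\pm(z)=\sum_{k\in\mathbb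 Z}X_{ik}^\pm z^{-k-1}$, $H_i(z)=\sum_{k\in\mathbb Z}H_{ik}z^{-k-1}$ ($i\in I$), with relations: $\mathbf C$ central; $[H_i(z),H_j(w)]=-2d_{ij}\delta_z(z,w)\mathbf C$; $[H_i(z),X_j^\pm(w)]=\pm2d_{ij}\delta(z,w)X_j^\pm(w)$; $[X_i^+(z),X_j^-(w)]=\delta_{ij}(\delta(z,w)H_i(z)-\delta_z(z,w)\mathbf C)$; $(z-w)[X_i^\pm(z),X_j^\pm(w)]=0$; $\mathrm{ad}(X_{i0}^\pm)^{1-a_{ij}}(X_j^\pm(z))=0$ for $i\ne j$; here $\delta(z,w)=\sum_{r\in\mathbb Z}z^rw^{-r-1}$ and $\delta_z(z,w)=\sum_{r\in\mathbb Z}rz^{r-1}w^{-r-1}$. The $\mathfrak t$-module $\mathcal V$. $\mathcal V=\mathbb C[\mathcal H_{i,-r}]_{i\in I,r>0}\otimes\mathbb C_\varepsilon[Q]$, where $\mathcal H_{i,-r}$ ($r>0$) acts by multiplication and $\mathcal H_{ir}$ ($r>0$) by $r\,\partial/\partial\mathcal H_{i,-r}$. The action of $\mathfrak t$ is the one determined by $$X_i^\pm(z)\mapsto\pm\exp\Big(\pm\sum_{r>0}\tfrac{\widetilde{\mathcal H}_{i,-r}}rz^r\Big)\exp\Big(\mp\sum_{r>0}\tfrac{\mathcal H_{ir}}rz^{-r}\Big)e^{\pm\alpha_i}z^{\partial_{\pm\alpha_i}},\quad\widetilde{\mathcal H}_{i,-r}=\sum_{j\in I}(\alpha_i,\alpha_j)\mathcal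 H_{j,-r},\quad \mathbf C\mapsto 1.$$ The $\mathfrak t$-module $\mathcal V_{\mathbf A}$. $\mathcal V_{\mathbf A}=\mathbb C[H_{i,-r}]_{i\in I,r>0}\otimes\mathbb C_\varepsilon[Q]$. On $f\otimes e^\lambda$: $H_{j,-s}$ ($s>0$) acts by multiplication on the first factor, $H_{j0}$ by the scalar $(\alpha_j,\lambda)$, and $H_{js}$ ($s>0$) by the derivation $\partial_{js}$ of the first factor with $\partial_{js}(H_{i,-r})=s(\alpha_i,\alpha_j)\delta_{sr}$. For $\alpha=\sum n_i\alpha_i\in Q$ put $H_{\alpha,r}=\sum n_iH_{ir}$ and $\mathds X_\alpha(z)=\exp(\sum_{r>0}\frac{H_{\alpha,-r}}rz^r)\exp(-\sum_{r>0}\frac{H_{\alpha,r}}rz^{-r})e^\alpha z^{\partial_\alpha}$. The action of $\mathfrak t$ is $X_i^\pm(z)\mapsto\pm\mathds X_{\pm\alpha_i}(z)$, $H_i(z)\mapsto\sum_{r\in\mathbb Z}H_{ir}z^{-r-1}$, $\mathbf C\mapsto1$. $\Phi_{\mathbf A}:\mathbb C[H_{i,-r}]_{i\in I,r>0}\to\mathbb C[\mathcal H_{i,-r}]_{i\in I,r>0}$ is the $\mathbb C$-algebra homomorphism with $\Phi_{\mathbf A}(H_{i,-r})=\sum_{j\in I}(\alpha_i,\alpha_j)\mathcal H_{j,-r}$ for $i\in I$, $r>0$. *)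

theory Defs
  imports "HOL-Analysis.Analysis" "HOL-Library.Poly_Mapping"
begin

section \<open>Complex Lie algebras given by generators and relations\<close>

text \<open>
  The Lie algebra presented by a type \<open>'g\<close> of generators and a set \<open>R\<close> of relations (pairs of
  terms to be identified) consists of the classes of Lie algebra terms modulo the least congruence
  \<open>lie_cong R\<close> that contains \<open>R\<close> and all instances of the axioms of a complex Lie algebra.
\<close>

datatype 'g lie_term =
    Gen 'g
  | LZero
  | LAdd "'g lie_term" "'g lie_term"
  | LScale complex "'g lie_term"
  | LBr "'g lie_term" "'g lie_term"

inductive lie_cong :: "('g lie_term \<times> 'g lie_term) set \<Rightarrow> 'g lie_term \<Rightarrow> 'g lie_term \<Rightarrow> bool"
  for R :: "('g lie_term \<times> 'g lie_term) set" where
  lc_rel: "(x, y) \<in> R \<Longrightarrow> lie_cong R x y"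
| lc_refl: "lie_cong R x x"
| lc_sym: "lie_cong R x y \<Longrightarrow> lie_cong R y x"
| lc_trans: "lie_cong R x y \<Longrightarrow> lie_cong R y z \<Longrightarrow> lie_cong R x z"
| lc_add: "lie_cong R x x' \<Longrightarrow> lie_cong R y y' \<Longrightarrow> lie_cong R (LAdd x y) (LAdd x' y')"
| lc_scale: "lie_cong R x x' \<Longrightarrow> lie_cong R (LScale c x) (LScale c x')"
| lc_br: "lie_cong R x x' \<Longrightarrow> lie_cong R y y' \<Longrightarrow> lie_cong R (LBr x y) (LBr x' y')"
| lc_add_assoc: "lie_cong R (LAdd (LAdd x y) z) (LAdd x (LAdd y z))"
| lc_add_commute: "lie_cong R (LAdd x y) (LAdd y x)"
| lc_add_zero: "lie_cong R (LAdd LZero x) x"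
| lc_add_minus: "lie_cong R (LAdd x (LScale (-1) x)) LZero"
| lc_scale_add_right: "lie_cong R (LScale c (LAdd x y)) (LAdd (LScale c x) (LScale c y))"
| lc_scale_add_left: "lie_cong R (LScale (c + d) x) (LAdd (LScale c x) (LScale d x))"
| lc_scale_scale: "lie_cong R (LScale c (LScale d x)) (LScale (c * d) x)"
| lc_scale_one: "lie_cong R (LScale 1 x) x"
| lc_br_add_left: "lie_cong R (LBr (LAdd x y) z) (LAdd (LBr x z) (LBr y z))"
| lc_br_add_right: "lie_cong R (LBr x (LAdd y z)) (LAdd (LBr x y) (LBr x z))"
| lc_br_scale_left: "lie_cong R (LBr (LScale c x) y) (LScale c (LBr x y))"
| lc_br_scale_right: "lie_cong R (LBr x (LScale c y)) (LScale c (LBr x y))"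
| lc_br_self: "lie_cong R (LBr x x) LZero"
| lc_jacobi:
    "lie_cong R (LAdd (LBr x (LBr y z)) (LAdd (LBr y (LBr z x)) (LBr z (LBr x y)))) LZero"

definition lie_class :: "('g lie_term \<times> 'g lie_term) set \<Rightarrow> 'g lie_term \<Rightarrow> 'g lie_term set" where
  "lie_class R x = {y. lie_cong R x y}"

definition lie_carrier :: "('g lie_term \<times> 'g lie_term) set \<Rightarrow> 'g lie_term set set" where
  "lie_carrier R = {lie_class R x | x. True}"

text \<open>
  On elements of \<open>lie_carrier R\<close> each of the following unions is over identical classes, see the
  lemmas \<open>cls_add_class\<close>, \<open>cls_scale_class\<close> and \<open>cls_br_class\<close>.
\<close>

definition cls_add ::
    "('g lie_term \<times> 'g lie_term) set \<Rightarrow> 'g lie_term set \<Rightarrow> 'g lie_term set \<Rightarrow> 'g lie_term set" where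
  "cls_add R X Y = (\<Union>x\<in>X. \<Union>y\<in>Y. lie_class R (LAdd x y))"

definition cls_scale ::
    "('g lie_term \<times> 'g lie_term) set \<Rightarrow> complex \<Rightarrow> 'g lie_term set \<Rightarrow> 'g lie_term set" where
  "cls_scale R c X = (\<Union>x\<in>X. lie_class R (LScale c x))"

definition cls_br ::
    "('g lie_term \<times> 'g lie_term) set \<Rightarrow> 'g lie_term set \<Rightarrow> 'g lie_term set \<Rightarrow> 'g lie_term set" where
  "cls_br R X Y = (\<Union>x\<in>X. \<Union>y\<in>Y. lie_class R (LBr x y))"

lemma lie_class_eq_iff: "lie_class R x = lie_class R y \<longleftrightarrow> lie_cong R x y"
  unfolding lie_class_def by (auto intro: lc_refl lc_sym lc_trans)

lemma cls_add_class: "cls_add R (lie_class R x) (lie_class R y) = lie_class R (LAdd x y)"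
  unfolding cls_add_def lie_class_def by (blast intro: lc_refl lc_trans lc_add)

lemma cls_scale_class: "cls_scale R c (lie_class R x) = lie_class R (LScale c x)"
  unfolding cls_scale_def lie_class_def by (blast intro: lc_refl lc_trans lc_scale)

lemma cls_br_class: "cls_br R (lie_class R x) (lie_class R y) = lie_class R (LBr x y)"
  unfolding cls_br_def lie_class_def by (blast intro: lc_refl lc_trans lc_br)

text \<open>
  A module over the presented Lie algebra, given by its action \<open>\<rho>\<close> on a complex vector space with
  scalar multiplication \<open>sc\<close>. The values of \<open>\<rho>\<close> outside \<open>lie_carrier R\<close> are irrelevant.
\<close>

definition lie_module ::
    "('g lie_term \<times> 'g lie_term) set \<Rightarrow> (complex \<Rightarrow> 'v::ab_group_add \<Rightarrow> 'v)
      \<Rightarrow> ('g lie_term set \<Rightarrow> 'v \<Rightarrow> 'v) \<Rightarrow> bool" where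
  "lie_module R sc \<rho> \<longleftrightarrow>
     vector_space sc \<and>
     (\<forall>X\<in>lie_carrier R. Vector_Spaces.linear sc sc (\<rho> X)) \<and>
     (\<forall>X\<in>lie_carrier R. \<forall>Y\<in>lie_carrier R. \<forall>v. \<rho> (cls_add R X Y) v = \<rho> X v + \<rho> Y v) \<and>
     (\<forall>X\<in>lie_carrier R. \<forall>c v. \<rho> (cls_scale R c X) v = sc c (\<rho> X v)) \<and>
     (\<forall>X\<in>lie_carrier R. \<forall>Y\<in>lie_carrier R. \<forall>v.
        \<rho> (cls_br R X Y) v = \<rho> X (\<rho> Y v) - \<rho> Y (\<rho> X v))"

definition lie_module_hom ::
    "('g lie_term \<times> 'g lie_term) set
      \<Rightarrow> (complex \<Rightarrow> 'v::ab_group_add \<Rightarrow> 'v) \<Rightarrow> ('g lie_term set \<Rightarrow> 'v \<Rightarrow> 'v)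
      \<Rightarrow> (complex \<Rightarrow> 'w::ab_group_add \<Rightarrow> 'w) \<Rightarrow> ('g lie_term set \<Rightarrow> 'w \<Rightarrow> 'w)
      \<Rightarrow> ('v \<Rightarrow> 'w) \<Rightarrow> bool" where
  "lie_module_hom R sc \<rho> sc' \<rho>' f \<longleftrightarrow>
     Vector_Spaces.linear sc sc' f \<and> (\<forall>X\<in>lie_carrier R. \<forall>v. f (\<rho> X v) = \<rho>' X (f v))"

definition lie_module_iso ::
    "('g lie_term \<times> 'g lie_term) set
      \<Rightarrow> (complex \<Rightarrow> 'v::ab_group_add \<Rightarrow> 'v) \<Rightarrow> ('g lie_term set \<Rightarrow> 'v \<Rightarrow> 'v)
      \<Rightarrow> (complex \<Rightarrow> 'w::ab_group_add \<Rightarrow> 'w) \<Rightarrow> ('g lie_term set \<Rightarrow> 'w \<Rightarrow> 'w)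
      \<Rightarrow> ('v \<Rightarrow> 'w) \<Rightarrow> bool" where
  "lie_module_iso R sc \<rho> sc' \<rho>' f \<longleftrightarrow>
     lie_module_hom R sc \<rho> sc' \<rho>' f \<and>
     (\<exists>g. lie_module_hom R sc' \<rho>' sc \<rho> g \<and> g \<circ> f = id \<and> f \<circ> g = id)"


section \<open>Cartan matrix, root lattice and cocycle\<close>

definition simply_laced_indecomposable :: "int ^ 'i::finite ^ 'i \<Rightarrow> bool" where
  "simply_laced_indecomposable A \<longleftrightarrow>
     transpose A = A \<and>
     (\<forall>i. A $ i $ i = 2) \<and>
     (\<forall>i j. i \<noteq> j \<longrightarrow> A $ i $ j \<in> {0, -1}) \<and>
     \<not> (\<exists>S. S \<noteq> {} \<and> S \<noteq> UNIV \<and> (\<forall>i\<in>S. \<forall>j\<in>-S. A $ i $ j = 0))"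

text \<open>The root lattice is \<open>int ^ 'i\<close>, with the form determined by \<open>(\<alpha>\<^sub>i, \<alpha>\<^sub>j) = a\<^sub>i\<^sub>j\<close>.\<close>

definition simple_root :: "'i::finite \<Rightarrow> int ^ 'i" where
  "simple_root i = axis i 1"

definition form :: "int ^ 'i::finite ^ 'i \<Rightarrow> int ^ 'i \<Rightarrow> int ^ 'i \<Rightarrow> int" where
  "form A \<alpha> \<beta> = (\<Sum>i\<in>UNIV. \<Sum>j\<in>UNIV. \<alpha> $ i * A $ i $ j * \<beta> $ j)"

definition cocycle :: "int ^ 'i::finite ^ 'i \<Rightarrow> (int ^ 'i \<Rightarrow> int ^ 'i \<Rightarrow> complex) \<Rightarrow> bool" where
  "cocycle A \<epsilon> \<longleftrightarrow>
     (\<forall>\<alpha> \<beta>. \<epsilon> \<alpha> \<beta> \<in> {1, -1}) \<and>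
     (\<forall>\<alpha> \<beta> \<gamma>. \<epsilon> (\<alpha> + \<beta>) \<gamma> = \<epsilon> \<alpha> \<gamma> * \<epsilon> \<beta> \<gamma>) \<and>
     (\<forall>\<alpha> \<beta> \<gamma>. \<epsilon> \<alpha> (\<beta> + \<gamma>) = \<epsilon> \<alpha> \<beta> * \<epsilon> \<alpha> \<gamma>) \<and>
     (\<forall>\<alpha>. \<epsilon> \<alpha> \<alpha> = (-1) powi (form A \<alpha> \<alpha> div 2))"


section \<open>The Lie algebra \<open>\<tt>\<close>\<close>

datatype sign_pm = Pos | Neg

fun sgn_int :: "sign_pm \<Rightarrow> int" where
  "sgn_int Pos = 1"
| "sgn_int Neg = -1"

text \<open>\<open>XG s i k\<close> is the coefficient of \<open>z\<^sup>-\<^sup>k\<^sup>-\<^sup>1\<close> in \<open>X\<^sub>i\<^sup>\<plusminus>(z)\<close>, and likewise \<open>HG i k\<close> for \<open>H\<^sub>i(z)\<close>.\<close>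

datatype 'i t_gen = CG | XG sign_pm 'i int | HG 'i int

text \<open>
  The relations, as coefficients of \<open>z\<^sup>-\<^sup>k\<^sup>-\<^sup>1 w\<^sup>-\<^sup>l\<^sup>-\<^sup>1\<close>, where \<open>2 d\<^sub>i\<^sub>j = (\<alpha>\<^sub>i, \<alpha>\<^sub>j) = a\<^sub>i\<^sub>j\<close>. That coefficient
  is \<open>-k\<close> if \<open>k + l = 0\<close> and \<open>0\<close> otherwise in \<open>\<delta>\<^sub>z(z,w) = \<Sum>\<^sub>r r z\<^sup>r\<^sup>-\<^sup>1 w\<^sup>-\<^sup>r\<^sup>-\<^sup>1\<close>, and it is \<open>Y\<^sub>k\<^sub>+\<^sub>l\<close> in
  \<open>\<delta>(z,w) Y(w)\<close> and in \<open>\<delta>(z,w) Y(z)\<close> if \<open>Y(z) = \<Sum>\<^sub>k Y\<^sub>k z\<^sup>-\<^sup>k\<^sup>-\<^sup>1\<close>.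
\<close>

definition delta_z :: "int \<Rightarrow> int \<Rightarrow> int" where
  "delta_z k l = (if k + l = 0 then - k else 0)"

inductive_set t_rels ::
    "int ^ 'i::finite ^ 'i \<Rightarrow> ('i t_gen lie_term \<times> 'i t_gen lie_term) set"
  for A :: "int ^ 'i ^ 'i" where
  central: "(LBr (Gen CG) (Gen g), LZero) \<in> t_rels A"
| HH: "(LBr (Gen (HG i k)) (Gen (HG j l)),
        LScale (of_int (- A $ i $ j * delta_z k l)) (Gen CG)) \<in> t_rels A"
| HX: "(LBr (Gen (HG i k)) (Gen (XG s j l)),
        LScale (of_int (sgn_int s * A $ i $ j)) (Gen (XG s j (k + l)))) \<in> t_rels A"
| XX_opp: "(LBr (Gen (XG Pos i k)) (Gen (XG Neg j l)),
        if i = j then LAdd (Gen (HG i (k + l))) (LScale (of_int (- delta_z k l)) (Gen CG))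
        else LZero) \<in> t_rels A"
| XX_same: "(LBr (Gen (XG s i (k + 1))) (Gen (XG s j l)),
        LBr (Gen (XG s i k)) (Gen (XG s j (l + 1)))) \<in> t_rels A"
| serre: "i \<noteq> j \<Longrightarrow>
        (((LBr (Gen (XG s i 0))) ^^ nat (1 - A $ i $ j)) (Gen (XG s j k)), LZero) \<in> t_rels A"

abbreviation t_gen_class :: "int ^ 'i::finite ^ 'i \<Rightarrow> 'i t_gen \<Rightarrow> 'i t_gen lie_term set" where
  "t_gen_class A g \<equiv> lie_class (t_rels A) (Gen g)"


section \<open>The common underlying space of \<open>\<V>\<close> and \<open>\<V>\<^sub>A\<close>\<close>

text \<open>
  Polynomials are finitely supported maps from monomials to \<open>\<complex>\<close>, where monomials are finitely
  supported exponent maps. The variable with index \<open>(i, n)\<close> stands for \<open>H\<^sub>i\<^sub>,\<^sub>-\<^sub>(\<^sub>n\<^sub>+\<^sub>1\<^sub>)\<close> (or its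
  calligraphic counterpart), so that exactly the indices \<open>-r\<close> with \<open>r > 0\<close> occur.
\<close>

type_synonym 'v cpoly = "('v \<Rightarrow>\<^sub>0 nat) \<Rightarrow>\<^sub>0 complex"

definition Const :: "complex \<Rightarrow> 'v cpoly" where
  "Const c = Poly_Mapping.single 0 c"

definition Var :: "'v \<Rightarrow> 'v cpoly" where
  "Var x = Poly_Mapping.single (Poly_Mapping.single x 1) 1"

definition partial_deriv :: "'v \<Rightarrow> 'v cpoly \<Rightarrow> 'v cpoly" where
  "partial_deriv x p =
     (\<Sum>m\<in>Poly_Mapping.keys p.
        Poly_Mapping.single (m - Poly_Mapping.single x 1)
          (of_nat (Poly_Mapping.lookup m x) * Poly_Mapping.lookup p m))"

text \<open>The \<open>\<complex>\<close>-algebra homomorphism that sends each variable \<open>x\<close> to \<open>s x\<close>.\<close>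

definition poly_subst :: "('v \<Rightarrow> 'w cpoly) \<Rightarrow> 'v cpoly \<Rightarrow> 'w cpoly" where
  "poly_subst s p =
     (\<Sum>m\<in>Poly_Mapping.keys p.
        Const (Poly_Mapping.lookup p m) * (\<Prod>x\<in>Poly_Mapping.keys m. s x ^ Poly_Mapping.lookup m x))"

type_synonym 'i hpoly = "('i \<times> nat) cpoly"

definition hvar :: "'i::finite \<Rightarrow> nat \<Rightarrow> 'i hpoly" where
  "hvar i r = Var (i, r - 1)"

text \<open>
  \<open>F \<otimes> \<complex>\<^sub>\<epsilon>[Q]\<close> with \<open>F\<close> the polynomial ring, as the free \<open>F\<close>-module on \<open>Q\<close>: the finitely supported
  map \<open>Poly_Mapping.single \<lambda> f\<close> is \<open>f \<otimes> e\<^sup>\<lambda>\<close>.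
\<close>

type_synonym 'i fock = "(int ^ 'i) \<Rightarrow>\<^sub>0 'i hpoly"

definition fscale :: "complex \<Rightarrow> 'i::finite fock \<Rightarrow> 'i fock" where
  "fscale c v = Poly_Mapping.map ((*) (Const c)) v"

definition fmult ::
    "(int ^ 'i::finite \<Rightarrow> int ^ 'i \<Rightarrow> complex) \<Rightarrow> 'i fock \<Rightarrow> 'i fock \<Rightarrow> 'i fock" where
  "fmult \<epsilon> v w =
     (\<Sum>\<alpha>\<in>Poly_Mapping.keys v. \<Sum>\<beta>\<in>Poly_Mapping.keys w.
        Poly_Mapping.single (\<alpha> + \<beta>)
          (Const (\<epsilon> \<alpha> \<beta>) * Poly_Mapping.lookup v \<alpha> * Poly_Mapping.lookup w \<beta>))"

definition fone :: "'i::finite fock" where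
  "fone = Poly_Mapping.single 0 1"

definition falgebra_hom ::
    "(int ^ 'i::finite \<Rightarrow> int ^ 'i \<Rightarrow> complex) \<Rightarrow> ('i fock \<Rightarrow> 'i fock) \<Rightarrow> bool" where
  "falgebra_hom \<epsilon> f \<longleftrightarrow>
     Vector_Spaces.linear fscale fscale f \<and> f fone = fone \<and>
     (\<forall>v w. f (fmult \<epsilon> v w) = fmult \<epsilon> (f v) (f w))"

definition falgebra_iso ::
    "(int ^ 'i::finite \<Rightarrow> int ^ 'i \<Rightarrow> complex) \<Rightarrow> ('i fock \<Rightarrow> 'i fock) \<Rightarrow> bool" where
  "falgebra_iso \<epsilon> f \<longleftrightarrow>
     falgebra_hom \<epsilon> f \<and> (\<exists>g. falgebra_hom \<epsilon> g \<and> g \<circ> f = id \<and> f \<circ> g = id)"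

text \<open>The operator \<open>T \<otimes> id\<close> for \<open>T\<close> with \<open>T 0 = 0\<close>.\<close>

definition on_fst :: "('i::finite hpoly \<Rightarrow> 'i hpoly) \<Rightarrow> 'i fock \<Rightarrow> 'i fock" where
  "on_fst T v = Poly_Mapping.map T v"

definition e_op ::
    "(int ^ 'i::finite \<Rightarrow> int ^ 'i \<Rightarrow> complex) \<Rightarrow> int ^ 'i \<Rightarrow> 'i fock \<Rightarrow> 'i fock" where
  "e_op \<epsilon> \<alpha> v = fmult \<epsilon> (Poly_Mapping.single \<alpha> 1) v"


section \<open>Formal series of operators\<close>

text \<open>
  A doubly infinite series \<open>\<Sum>\<^sub>n a\<^sub>n z\<^sup>n\<close> of operators is the function \<open>n \<mapsto> a\<^sub>n\<close>. The infinite sums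
  below have, for each argument \<open>v\<close>, only finitely many nonzero terms for the series to which
  they are applied here; \<open>Sum_any\<close> is the sum over the support.
\<close>

type_synonym 'i op_series = "int \<Rightarrow> 'i fock \<Rightarrow> 'i fock"

definition ser_const :: "('i::finite fock \<Rightarrow> 'i fock) \<Rightarrow> 'i op_series" where
  "ser_const T n v = (if n = 0 then T v else 0)"

definition ser_mult :: "'i::finite op_series \<Rightarrow> 'i op_series \<Rightarrow> 'i op_series" where
  "ser_mult a b n v = Sum_any (\<lambda>k. a (n - k) (b k v))"

primrec ser_pow :: "'i::finite op_series \<Rightarrow> nat \<Rightarrow> 'i op_series" where
  "ser_pow a 0 = ser_const id"
| "ser_pow a (Suc n) = ser_mult a (ser_pow a n)"

definition ser_exp :: "'i::finite op_series \<Rightarrow> 'i op_series" where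
  "ser_exp a m v = Sum_any (\<lambda>n. fscale (1 / fact n) (ser_pow a n m v))"

text \<open>\<open>z\<^bsup>\<partial>\<^sub>\<alpha>\<^esup>\<close>: its coefficient of \<open>z\<^sup>n\<close> projects to the \<open>f \<otimes> e\<^sup>\<beta>\<close> with \<open>(\<alpha>, \<beta>) = n\<close>.\<close>

definition z_partial :: "int ^ 'i::finite ^ 'i \<Rightarrow> int ^ 'i \<Rightarrow> 'i op_series" where
  "z_partial A \<alpha> n v = Poly_Mapping.mapp (\<lambda>\<beta> f. if form A \<alpha> \<beta> = n then f else 0) v"

text \<open>
  For families of operators \<open>a\<^sub>r\<close>, \<open>b\<^sub>r\<close> (\<open>r > 0\<close>), the series
  \<open>exp(\<Sum>\<^bsub>r>0\<^esub> a\<^sub>r/r z\<^sup>r) exp(- \<Sum>\<^bsub>r>0\<^esub> b\<^sub>r/r z\<^sup>-\<^sup>r) e\<^sup>\<alpha> z\<^bsup>\<partial>\<^sub>\<alpha>\<^esup>\<close>.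
\<close>

definition vertex_series ::
    "int ^ 'i::finite ^ 'i \<Rightarrow> (int ^ 'i \<Rightarrow> int ^ 'i \<Rightarrow> complex)
      \<Rightarrow> (nat \<Rightarrow> 'i fock \<Rightarrow> 'i fock) \<Rightarrow> (nat \<Rightarrow> 'i fock \<Rightarrow> 'i fock) \<Rightarrow> int ^ 'i \<Rightarrow> 'i op_series" where
  "vertex_series A \<epsilon> a b \<alpha> =
     ser_mult (ser_exp (\<lambda>n v. if n > 0 then fscale (1 / of_int n) (a (nat n) v) else 0))
     (ser_mult (ser_exp (\<lambda>n v. if n < 0 then fscale (- 1 / of_int (- n)) (b (nat (- n)) v) else 0))
     (ser_mult (ser_const (e_op \<epsilon> \<alpha>)) (z_partial A \<alpha>)))"


section \<open>The \<open>\<tt>\<close>-module \<open>\<V>\<close>\<close>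

definition cH_neg :: "'i::finite \<Rightarrow> nat \<Rightarrow> 'i fock \<Rightarrow> 'i fock" where
  "cH_neg i r = on_fst ((*) (hvar i r))"

definition cH_pos :: "'i::finite \<Rightarrow> nat \<Rightarrow> 'i fock \<Rightarrow> 'i fock" where
  "cH_pos i r = on_fst (\<lambda>f. of_nat r * partial_deriv (i, r - 1) f)"

definition cH_tilde_neg :: "int ^ 'i::finite ^ 'i \<Rightarrow> 'i \<Rightarrow> nat \<Rightarrow> 'i fock \<Rightarrow> 'i fock" where
  "cH_tilde_neg A i r v =
     (\<Sum>j\<in>UNIV. fscale (of_int (form A (simple_root i) (simple_root j))) (cH_neg j r v))"

definition cX_series ::
    "int ^ 'i::finite ^ 'i \<Rightarrow> (int ^ 'i \<Rightarrow> int ^ 'i \<Rightarrow> complex) \<Rightarrow> sign_pm \<Rightarrow> 'i \<Rightarrow> 'i op_series" where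
  "cX_series A \<epsilon> s i n v =
     fscale (of_int (sgn_int s))
       (vertex_series A \<epsilon>
         (\<lambda>r w. fscale (of_int (sgn_int s)) (cH_tilde_neg A i r w))
         (\<lambda>r w. fscale (of_int (sgn_int s)) (cH_pos i r w))
         (if s = Pos then simple_root i else - simple_root i) n v)"

text \<open>The action of the \<open>H\<^sub>i\<^sub>k\<close> is determined by that of the \<open>X\<^sub>i\<^sub>k\<^sup>\<plusminus>\<close> and \<open>C\<close>, by the relation \<open>XX_opp\<close>.\<close>

definition is_module_V ::
    "int ^ 'i::finite ^ 'i \<Rightarrow> (int ^ 'i \<Rightarrow> int ^ 'i \<Rightarrow> complex)
      \<Rightarrow> ('i t_gen lie_term set \<Rightarrow> 'i fock \<Rightarrow> 'i fock) \<Rightarrow> bool" where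
  "is_module_V A \<epsilon> \<rho> \<longleftrightarrow>
     lie_module (t_rels A) fscale \<rho> \<and>
     (\<forall>s i k v. \<rho> (t_gen_class A (XG s i k)) v = cX_series A \<epsilon> s i (- k - 1) v) \<and>
     (\<forall>v. \<rho> (t_gen_class A CG) v = v)"


section \<open>The \<open>\<tt>\<close>-module \<open>\<V>\<^sub>A\<close>\<close>

text \<open>\<open>H_deriv A j s\<close> is the derivation \<open>\<partial>\<^sub>j\<^sub>s\<close> with \<open>\<partial>\<^sub>j\<^sub>s (H\<^sub>i\<^sub>,\<^sub>-\<^sub>r) = s (\<alpha>\<^sub>i, \<alpha>\<^sub>j) \<delta>\<^sub>s\<^sub>r\<close>.\<close>

definition H_deriv :: "int ^ 'i::finite ^ 'i \<Rightarrow> 'i \<Rightarrow> nat \<Rightarrow> 'i hpoly \<Rightarrow> 'i hpoly" where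
  "H_deriv A j s f =
     (\<Sum>i\<in>UNIV. Const (of_nat s * of_int (form A (simple_root i) (simple_root j)))
        * partial_deriv (i, s - 1) f)"

definition H_op :: "int ^ 'i::finite ^ 'i \<Rightarrow> 'i \<Rightarrow> int \<Rightarrow> 'i fock \<Rightarrow> 'i fock" where
  "H_op A j k v =
     (if k < 0 then on_fst ((*) (hvar j (nat (- k)))) v
      else if k = 0 then
        Poly_Mapping.mapp (\<lambda>\<beta> f. Const (of_int (form A (simple_root j) \<beta>)) * f) v
      else on_fst (H_deriv A j (nat k)) v)"

definition H_lin :: "int ^ 'i::finite ^ 'i \<Rightarrow> int ^ 'i \<Rightarrow> int \<Rightarrow> 'i fock \<Rightarrow> 'i fock" where
  "H_lin A \<alpha> k v = (\<Sum>i\<in>UNIV. fscale (of_int (\<alpha> $ i)) (H_op A i k v))"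

definition X_series ::
    "int ^ 'i::finite ^ 'i \<Rightarrow> (int ^ 'i \<Rightarrow> int ^ 'i \<Rightarrow> complex) \<Rightarrow> int ^ 'i \<Rightarrow> 'i op_series" where
  "X_series A \<epsilon> \<alpha> =
     vertex_series A \<epsilon> (\<lambda>r. H_lin A \<alpha> (- int r)) (\<lambda>r. H_lin A \<alpha> (int r)) \<alpha>"

definition is_module_VA ::
    "int ^ 'i::finite ^ 'i \<Rightarrow> (int ^ 'i \<Rightarrow> int ^ 'i \<Rightarrow> complex)
      \<Rightarrow> ('i t_gen lie_term set \<Rightarrow> 'i fock \<Rightarrow> 'i fock) \<Rightarrow> bool" where
  "is_module_VA A \<epsilon> \<rho> \<longleftrightarrow>
     lie_module (t_rels A) fscale \<rho> \<and>
     (\<forall>i k v. \<rho> (t_gen_class A (XG Pos i k)) v = X_series A \<epsilon> (simple_root i) (- k - 1) v) \<and>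
     (\<forall>i k v. \<rho> (t_gen_class A (XG Neg i k)) v = - X_series A \<epsilon> (- simple_root i) (- k - 1) v) \<and>
     (\<forall>i k v. \<rho> (t_gen_class A (HG i k)) v = H_op A i k v) \<and>
     (\<forall>v. \<rho> (t_gen_class A CG) v = v)"


section \<open>The map \<open>\<Phi>\<^sub>A \<otimes> id\<close>\<close>

definition Phi :: "int ^ 'i::finite ^ 'i \<Rightarrow> 'i hpoly \<Rightarrow> 'i hpoly" where
  "Phi A = poly_subst (\<lambda>(i, n).
     \<Sum>j\<in>UNIV. Const (of_int (form A (simple_root i) (simple_root j))) * hvar j (n + 1))"

definition Phi_id :: "int ^ 'i::finite ^ 'i \<Rightarrow> 'i fock \<Rightarrow> 'i fock" where
  "Phi_id A = on_fst (Phi A)"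

end

theory Submission
  imports Defs
begin

text \<open>
  Both vertex operators are built by the same formula from a pair of families of operators on the
  first tensor factor, and \<open>\<Phi>\<^sub>A\<close> intertwines these families: for the multiplication operators this
  is the definition of \<open>\<Phi>\<^sub>A\<close>, for the derivations it is the chain rule. Hence \<open>\<Phi>\<^sub>A \<otimes> id\<close> commutes with
  the coefficients of \<open>X\<^sub>i\<^sup>\<plusminus>(z)\<close>, and with \<open>C\<close>, which together generate \<open>\<tt>\<close>. As \<open>\<Phi>\<^sub>A\<close> may kill
  nonzero terms, the sums over supports can only be compared once those on the side of \<open>\<V>\<^sub>A\<close> are
  known to be finite, for which the weight grading with \<open>H\<^sub>i\<^sub>,\<^sub>-\<^sub>r\<close> of weight \<open>r\<close> is used. Finally,
  \<open>\<Phi>\<^sub>A\<close> is the linear substitution with matrix \<open>A\<close>: an inverse matrix gives an inverse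
  substitution, and a vector in the left kernel of \<open>A\<close> gives a linear form in the kernel of \<open>\<Phi>\<^sub>A\<close>.
\<close>

subsection \<open>Polynomials\<close>

text \<open>Serves at two levels: a polynomial is a sum of terms, and a monomial, being itself a
  finitely supported map, is a sum of powers of single variables.\<close>

lemma poly_mapping_induct [case_names single add]:
  fixes p :: "'a \<Rightarrow>\<^sub>0 'b::comm_monoid_add"
  assumes "\<And>k c. P (Poly_Mapping.single k c)"
    and "\<And>p q. P p \<Longrightarrow> P q \<Longrightarrow> P (p + q)"
  shows "P p"
proof (induction p rule: update_induct)
  case const
  show ?case using assms(1)[of undefined 0] by simp
next
  case (update p k c)
  have "Poly_Mapping.update k c p = p + Poly_Mapping.single k c"
    using update.hyps
    by (intro poly_mapping_eqI) (auto simp: lookup_update lookup_add lookup_single when_def in_keys_iff)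
  with update.IH show ?case by (simp add: assms)
qed

lemma Const_0 [simp]: "Const 0 = 0"
  and Const_1 [simp]: "Const 1 = 1"
  and Const_add: "Const (c + d) = Const c + Const d"
  and Const_mult: "Const (c * d) = Const c * Const d"
  and Const_uminus: "Const (- c) = - Const c"
  by (simp_all add: Const_def single_add single_uminus mult_single)

lemma Const_of_nat: "Const (of_nat n) = of_nat n"
  by (simp add: Const_def)

lemma Const_sum: "Const (\<Sum>x\<in>X. f x) = (\<Sum>x\<in>X. Const (f x))"
  by (induction X rule: infinite_finite_induct) (simp_all add: Const_add)

lemma Var_power: "Var x ^ n = Poly_Mapping.single (Poly_Mapping.single x n) 1"
  by (induction n) (simp_all add: Var_def mult_single flip: single_add)

lemma single_eq_Const_mult: "Poly_Mapping.single m c = Const c * Poly_Mapping.single m 1"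
  by (simp add: Const_def mult_single)

text \<open>Constants and variables generate the polynomial algebra. Exponents are written
  additively, so the sum case for a monomial is a product of polynomials.\<close>

lemma cpoly_induct [case_names Const Var add mult]:
  fixes p :: "'v cpoly"
  assumes Const: "\<And>c. P (Const c)"
    and Var: "\<And>x. P (Var x)"
    and add: "\<And>p q. P p \<Longrightarrow> P q \<Longrightarrow> P (p + q)"
    and mult: "\<And>p q. P p \<Longrightarrow> P q \<Longrightarrow> P (p * q)"
  shows "P p"
proof (induction p rule: poly_mapping_induct)
  case (single m c)
  have pow: "P (Var x ^ n)" for x n
    using Const[of 1] by (induction n) (simp_all add: Var mult)
  have "P (Poly_Mapping.single m 1)"
  proof (induction m rule: poly_mapping_induct)
    case (single x n)
    show ?case using pow[of x n] by (simp add: Var_power)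
  next
    case (add m m')
    then show ?case using mult[OF add] by (simp add: mult_single)
  qed
  then show ?case by (subst single_eq_Const_mult) (intro mult Const)
qed (rule add)


subsection \<open>Partial derivatives\<close>

lemma partial_deriv_add: "partial_deriv x (p + q) = partial_deriv x p + partial_deriv x q"
  unfolding partial_deriv_def
  by (rule setsum_keys_plus_distrib) (simp_all add: single_add algebra_simps)

lemma partial_deriv_single:
  "partial_deriv x (Poly_Mapping.single m c) =
    Poly_Mapping.single (m - Poly_Mapping.single x 1) (of_nat (Poly_Mapping.lookup m x) * c)"
  by (simp add: partial_deriv_def)

lemma partial_deriv_0 [simp]: "partial_deriv x 0 = 0"
  by (simp add: partial_deriv_def)

lemma partial_deriv_Const [simp]: "partial_deriv x (Const c) = 0"
  by (simp add: Const_def partial_deriv_single)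

lemma partial_deriv_Var: "partial_deriv x (Var y) = (if x = y then 1 else 0)"
  by (simp add: Var_def partial_deriv_single lookup_single)

lemma partial_deriv_mult:
  "partial_deriv x (p * q) = partial_deriv x p * q + p * partial_deriv x q"
proof (induction p rule: poly_mapping_induct)
  case (single m c)
  show ?case
  proof (induction q rule: poly_mapping_induct)
    case (single n d)
    let ?x = "Poly_Mapping.single x (1::nat)"
    \<comment> \<open>Subtraction of exponents is truncated. If \<open>x\<close> does not occur in
      \<open>m'\<close>, the two exponents may differ, but then the coefficient is 0.\<close>
    have shift: "Poly_Mapping.single (m' - ?x + n') (of_nat (Poly_Mapping.lookup m' x) * e) =
        Poly_Mapping.single (m' + n' - ?x) (of_nat (Poly_Mapping.lookup m' x) * e)"
      for m' n' :: "'a \<Rightarrow>\<^sub>0 nat" and e :: complex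
    proof (cases "Poly_Mapping.lookup m' x = 0")
      case False
      then have "m' - ?x + n' = m' + n' - ?x"
        by (intro poly_mapping_eqI) (auto simp: lookup_add lookup_minus lookup_single when_def)
      then show ?thesis by simp
    qed simp
    show ?case
      using shift[of m n "c * d"] shift[of n m "c * d"]
      by (simp add: partial_deriv_single mult_single lookup_add ring_distribs single_add mult.assoc
          mult.left_commute[of c] add.commute[of m])
  qed (simp add: partial_deriv_add algebra_simps)
qed (simp add: partial_deriv_add algebra_simps)

lemma partial_deriv_sum: "partial_deriv x (\<Sum>i\<in>I. f i) = (\<Sum>i\<in>I. partial_deriv x (f i))"
  by (induction I rule: infinite_finite_induct) (simp_all add: partial_deriv_add)


subsection \<open>Substitution homomorphisms\<close>

lemma poly_subst_add: "poly_subst s (p + q) = poly_subst s p + poly_subst s q"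
  unfolding poly_subst_def
  by (rule setsum_keys_plus_distrib) (simp_all add: Const_add algebra_simps)

lemma poly_subst_single:
  "poly_subst s (Poly_Mapping.single m c) =
    Const c * (\<Prod>x\<in>Poly_Mapping.keys m. s x ^ Poly_Mapping.lookup m x)"
  by (simp add: poly_subst_def)

lemma poly_subst_0 [simp]: "poly_subst s 0 = 0"
  by (simp add: poly_subst_def)

lemma poly_subst_Const [simp]: "poly_subst s (Const c) = Const c"
  by (subst Const_def) (simp add: poly_subst_single)

lemma poly_subst_Var [simp]: "poly_subst s (Var x) = s x"
  by (simp add: Var_def poly_subst_single)

lemma poly_subst_mult: "poly_subst s (p * q) = poly_subst s p * poly_subst s q"
proof (induction p rule: poly_mapping_induct)
  case (single m c)
  show ?case
  proof (induction q rule: poly_mapping_induct)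
    case (single n d)
    let ?K = "Poly_Mapping.keys m \<union> Poly_Mapping.keys n"
    \<comment> \<open>Over the union of both supports, where the additional factors are zeroth
      powers, the exponents can be added factor by factor.\<close>
    have expand: "(\<Prod>x\<in>Poly_Mapping.keys k. s x ^ Poly_Mapping.lookup k x) =
        (\<Prod>x\<in>?K. s x ^ Poly_Mapping.lookup k x)" if "Poly_Mapping.keys k \<subseteq> ?K" for k
      using that by (intro prod.mono_neutral_left) (auto simp: in_keys_iff)
    show ?case
      unfolding mult_single poly_subst_single expand[OF keys_add] expand[OF Un_upper1] expand[OF Un_upper2]
      by (simp add: lookup_add power_add prod.distrib Const_mult algebra_simps)
  qed (simp add: poly_subst_add algebra_simps)
qed (simp add: poly_subst_add algebra_simps)

lemma poly_subst_1 [simp]: "poly_subst s 1 = 1"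
  using poly_subst_Const[of s 1] by simp

lemma poly_subst_sum: "poly_subst s (\<Sum>i\<in>I. f i) = (\<Sum>i\<in>I. poly_subst s (f i))"
  by (induction I rule: infinite_finite_induct) (simp_all add: poly_subst_add)

lemma poly_subst_poly_subst: "poly_subst s (poly_subst t p) = poly_subst (\<lambda>x. poly_subst s (t x)) p"
  by (induction p rule: cpoly_induct) (simp_all add: poly_subst_add poly_subst_mult)

lemma poly_subst_Var_id: "poly_subst Var p = p"
  by (induction p rule: cpoly_induct) (simp_all add: poly_subst_add poly_subst_mult)

text \<open>Chain rule. Both sides satisfy the same Leibniz rule along \<open>poly_subst s\<close>,
  so constants and variables suffice. There may be infinitely many variables; \<open>X\<close>
  confines the sum to those whose images can have a nonzero derivative.\<close>

lemma partial_deriv_poly_subst: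
  assumes "finite X" and "\<And>x. x \<notin> X \<Longrightarrow> partial_deriv y (s x) = 0"
  shows "partial_deriv y (poly_subst s p) =
    (\<Sum>x\<in>X. partial_deriv y (s x) * poly_subst s (partial_deriv x p))"
proof (induction p rule: cpoly_induct)
  case (Var z)
  show ?case
  proof (cases "z \<in> X")
    case True
    with assms(1) show ?thesis
      by (simp add: partial_deriv_Var if_distrib[of "poly_subst s"] if_distrib[of "(*) _"] cong: if_cong)
  next
    case False
    then have "(\<Sum>x\<in>X. partial_deriv y (s x) * poly_subst s (partial_deriv x (Var z))) = 0"
      by (intro sum.neutral) (auto simp: partial_deriv_Var)
    with False show ?thesis by (simp add: assms(2))
  qed
qed (simp_all add: partial_deriv_add partial_deriv_mult poly_subst_add poly_subst_mult sum.distrib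
    sum_distrib_left sum_distrib_right algebra_simps)

subsection \<open>Weights\<close>

text \<open>The variable \<open>(i, n)\<close> stands for the mode \<open>-(n + 1)\<close>, hence
  the \<open>Suc\<close>.\<close>

definition weight :: "(('i \<times> nat) \<Rightarrow>\<^sub>0 nat) \<Rightarrow> nat" where
  "weight m = (\<Sum>x\<in>Poly_Mapping.keys m. Poly_Mapping.lookup m x * Suc (snd x))"

lemma weight_add: "weight (m + n) = weight m + weight n"
  unfolding weight_def by (rule setsum_keys_plus_distrib) (simp_all add: algebra_simps)

lemma weight_single [simp]: "weight (Poly_Mapping.single x k) = k * Suc (snd x)"
  by (simp add: weight_def)

text \<open>The bound is an integer so that a negative one forces the vector to be zero.\<close>

definition weight_le :: "int \<Rightarrow> 'i::finite fock \<Rightarrow> bool" where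
  "weight_le d v \<longleftrightarrow>
    (\<forall>\<beta>. \<forall>m\<in>Poly_Mapping.keys (Poly_Mapping.lookup v \<beta>). int (weight m) \<le> d)"

lemma weight_le_exists: "\<exists>d. weight_le d v"
proof -
  let ?W = "\<Union>\<beta>\<in>Poly_Mapping.keys v. weight ` Poly_Mapping.keys (Poly_Mapping.lookup v \<beta>)"
  have fin: "finite ?W" by simp
  have "weight_le (int (Max ?W)) v"
    unfolding weight_le_def
  proof (intro allI ballI)
    fix \<beta> m
    assume m: "m \<in> Poly_Mapping.keys (Poly_Mapping.lookup v \<beta>)"
    then have "\<beta> \<in> Poly_Mapping.keys v" by (auto simp: in_keys_iff)
    with m have "weight m \<in> ?W" by blast
    with fin show "int (weight m) \<le> int (Max ?W)" by simp
  qed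
  then show ?thesis ..
qed

lemma weight_le_neg_imp_0:
  assumes "weight_le d v" "d < 0"
  shows "v = 0"
proof (rule poly_mapping_eqI)
  fix \<beta>
  have "Poly_Mapping.keys (Poly_Mapping.lookup v \<beta>) = {}"
    using assms by (force simp: weight_le_def)
  then show "Poly_Mapping.lookup v \<beta> = Poly_Mapping.lookup 0 \<beta>" by simp
qed

lemma weight_le_0 [simp]: "weight_le d 0"
  by (simp add: weight_le_def)

lemma weight_le_add: "weight_le d v \<Longrightarrow> weight_le d w \<Longrightarrow> weight_le d (v + w)"
  unfolding weight_le_def lookup_add using keys_add by fastforce

lemma weight_le_sum: "(\<And>i. i \<in> I \<Longrightarrow> weight_le d (f i)) \<Longrightarrow> weight_le d (\<Sum>i\<in>I. f i)"
  by (induction I rule: infinite_finite_induct) (simp_all add: weight_le_add)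

lemma weight_le_Sum_any: "(\<And>i. weight_le d (f i)) \<Longrightarrow> weight_le d (Sum_any f)"
  unfolding Sum_any.expand_set by (rule weight_le_sum)


subsection \<open>Operators on the Fock space\<close>

lemma lookup_on_fst: "T 0 = 0 \<Longrightarrow> Poly_Mapping.lookup (on_fst T v) \<beta> = T (Poly_Mapping.lookup v \<beta>)"
  by (simp add: on_fst_def map.rep_eq when_def)

lemma lookup_fscale: "Poly_Mapping.lookup (fscale c v) \<beta> = Const c * Poly_Mapping.lookup v \<beta>"
  by (simp add: fscale_def map.rep_eq when_def)

lemma lookup_z_partial:
  "Poly_Mapping.lookup (z_partial A \<alpha> n v) \<beta> =
    (if form A \<alpha> \<beta> = n then Poly_Mapping.lookup v \<beta> else 0)"
  by (auto simp: z_partial_def lookup_mapp when_def in_keys_iff)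

lemma fscale_0_right [simp]: "fscale c 0 = 0"
  by (intro poly_mapping_eqI) (simp add: lookup_fscale)

lemma fscale_0_left [simp]: "fscale 0 v = 0"
  by (intro poly_mapping_eqI) (simp add: lookup_fscale)

lemma fscale_1 [simp]: "fscale 1 v = v"
  by (intro poly_mapping_eqI) (simp add: lookup_fscale)

lemma fscale_minus1 [simp]: "fscale (- 1) v = - v"
  by (intro poly_mapping_eqI) (simp add: lookup_fscale Const_uminus)

lemma vector_space_fscale: "vector_space (fscale :: complex \<Rightarrow> 'i::finite fock \<Rightarrow> 'i fock)"
  by unfold_locales
    (auto intro!: poly_mapping_eqI simp: lookup_fscale lookup_add Const_add Const_mult algebra_simps)

lemma on_fst_0 [simp]: "on_fst T 0 = 0"
  by (simp add: on_fst_def map_eq_zero_iff)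

lemma on_fst_add:
  assumes "\<And>p q. T (p + q) = T p + T q"
  shows "on_fst T (v + w) = on_fst T v + on_fst T w"
proof -
  have "T 0 = 0" using assms[of 0 0] by simp
  then show ?thesis
    by (intro poly_mapping_eqI) (simp add: lookup_on_fst lookup_add assms)
qed

lemma on_fst_fscale:
  assumes "T 0 = 0" and "\<And>p. T (Const c * p) = Const c * T p"
  shows "on_fst T (fscale c v) = fscale c (on_fst T v)"
  using assms by (intro poly_mapping_eqI) (simp add: lookup_on_fst lookup_fscale)

lemma on_fst_single: "T 0 = 0 \<Longrightarrow> on_fst T (Poly_Mapping.single \<beta> p) = Poly_Mapping.single \<beta> (T p)"
  by (simp add: on_fst_def)

lemma on_fst_on_fst: "S 0 = 0 \<Longrightarrow> T 0 = 0 \<Longrightarrow> on_fst S (on_fst T v) = on_fst (\<lambda>p. S (T p)) v"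
  by (intro poly_mapping_eqI) (simp add: lookup_on_fst)

lemma on_fst_z_partial: "T 0 = 0 \<Longrightarrow> on_fst T (z_partial A \<alpha> n v) = z_partial A \<alpha> n (on_fst T v)"
  by (intro poly_mapping_eqI) (simp add: lookup_on_fst lookup_z_partial)

text \<open>An operator on the coefficients can shrink supports; with larger index sets, products
  before and after it can be compared term by term.\<close>

lemma fmult_superset:
  assumes "finite K" "Poly_Mapping.keys v \<subseteq> K" "finite L" "Poly_Mapping.keys w \<subseteq> L"
  shows "fmult \<epsilon> v w = (\<Sum>\<alpha>\<in>K. \<Sum>\<beta>\<in>L. Poly_Mapping.single (\<alpha> + \<beta>)
    (Const (\<epsilon> \<alpha> \<beta>) * Poly_Mapping.lookup v \<alpha> * Poly_Mapping.lookup w \<beta>))"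
proof -
  have "fmult \<epsilon> v w = (\<Sum>\<alpha>\<in>Poly_Mapping.keys v. \<Sum>\<beta>\<in>L. Poly_Mapping.single (\<alpha> + \<beta>)
      (Const (\<epsilon> \<alpha> \<beta>) * Poly_Mapping.lookup v \<alpha> * Poly_Mapping.lookup w \<beta>))"
    unfolding fmult_def using assms
    by (intro sum.cong refl sum.mono_neutral_left) (auto simp: in_keys_iff)
  also have "\<dots> = (\<Sum>\<alpha>\<in>K. \<Sum>\<beta>\<in>L. Poly_Mapping.single (\<alpha> + \<beta>)
      (Const (\<epsilon> \<alpha> \<beta>) * Poly_Mapping.lookup v \<alpha> * Poly_Mapping.lookup w \<beta>))"
    using assms by (intro sum.mono_neutral_left) (auto simp: in_keys_iff)
  finally show ?thesis .
qed

lemma e_op_0 [simp]: "e_op \<epsilon> \<alpha> 0 = 0"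
  by (simp add: e_op_def fmult_def)

section \<open>Algebra endomorphisms of the first tensor factor\<close>

context
  fixes T :: "'i::finite hpoly \<Rightarrow> 'i hpoly"
  assumes T_add: "\<And>p q. T (p + q) = T p + T q"
    and T_mult: "\<And>p q. T (p * q) = T p * T q"
    and T_Const: "\<And>c. T (Const c) = Const c"
begin

lemma on_fst_hom_0: "T 0 = 0"
  using T_Const[of 0] by simp

lemma on_fst_fmult: "on_fst T (fmult \<epsilon> v w) = fmult \<epsilon> (on_fst T v) (on_fst T w)"
proof -
  have on_fst_sum: "on_fst T (\<Sum>i\<in>I. f i) = (\<Sum>i\<in>I. on_fst T (f i))" for I :: "(int ^ 'i) set" and f
    by (induction I rule: infinite_finite_induct) (simp_all add: on_fst_add[OF T_add])
  have keys: "Poly_Mapping.keys (on_fst T u) \<subseteq> Poly_Mapping.keys u" for u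
    by (auto simp: in_keys_iff lookup_on_fst[of T, OF on_fst_hom_0] on_fst_hom_0)
  show ?thesis
    by (subst fmult_superset[of "Poly_Mapping.keys v" _ "Poly_Mapping.keys w"])
      (simp_all add: keys fmult_def on_fst_sum on_fst_single on_fst_hom_0 T_mult T_Const lookup_on_fst)
qed

lemma linear_on_fst: "Vector_Spaces.linear fscale fscale (on_fst T)"
  unfolding Vector_Spaces.linear_iff using vector_space_fscale
  by (simp add: on_fst_add T_add on_fst_fscale on_fst_hom_0 T_mult T_Const)

lemma falgebra_hom_on_fst: "falgebra_hom \<epsilon> (on_fst T)"
proof -
  have "T 1 = 1" using T_Const[of 1] by simp
  then show ?thesis
    by (simp add: falgebra_hom_def linear_on_fst fone_def on_fst_single on_fst_hom_0 on_fst_fmult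
        del: single_one)
qed

lemma on_fst_e_op: "on_fst T (e_op \<epsilon> \<alpha> v) = e_op \<epsilon> \<alpha> (on_fst T v)"
proof -
  have "T 1 = 1" using T_Const[of 1] by simp
  then show ?thesis
    by (simp add: e_op_def on_fst_fmult on_fst_single on_fst_hom_0)
qed

end

section \<open>Weight bounds for operators on the Fock space\<close>

lemma weight_le_on_fst:
  assumes "T 0 = 0"
    and "\<And>p m. m \<in> Poly_Mapping.keys (T p) \<Longrightarrow> \<exists>n\<in>Poly_Mapping.keys p. int (weight m) \<le> int (weight n) + e"
    and "weight_le d v"
  shows "weight_le (d + e) (on_fst T v)"
  using assms unfolding weight_le_def by (force simp: lookup_on_fst)

lemma weight_le_fscale: "weight_le d v \<Longrightarrow> weight_le d (fscale c v)"
proof -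
  assume d: "weight_le d v"
  have "Poly_Mapping.keys (Const c * p) \<subseteq> Poly_Mapping.keys p" for p :: "'a hpoly"
    using keys_mult[of "Const c" p] by (auto simp: Const_def split: if_splits)
  with d show ?thesis unfolding weight_le_def lookup_fscale by blast
qed

lemma weight_le_partial_deriv:
  assumes "0 < r" "weight_le d v"
  shows "weight_le (d - int r) (on_fst (partial_deriv (i, r - 1)) v)"
proof -
  have "\<exists>n\<in>Poly_Mapping.keys p. int (weight m) \<le> int (weight n) + (- int r)"
    if m': "m \<in> Poly_Mapping.keys (partial_deriv (i, r - 1) p)" for p :: "'a hpoly" and m
  proof -
    let ?x = "Poly_Mapping.single (i, r - 1) (1::nat)"
    obtain n where n: "n \<in> Poly_Mapping.keys p" and m: "m \<in> Poly_Mapping.keys (Poly_Mapping.single (n - ?x)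
        (of_nat (Poly_Mapping.lookup n (i, r - 1)) * Poly_Mapping.lookup p n))"
      using subsetD[OF keys_sum m'[unfolded partial_deriv_def]] by blast
    then have eq: "m = n - ?x" and pos: "Poly_Mapping.lookup n (i, r - 1) \<noteq> 0"
      by (auto split: if_splits)
    \<comment> \<open>The nonzero coefficient makes the exponent positive, so the truncated
      subtraction can be undone.\<close>
    have "n = m + ?x"
      unfolding eq using pos
      by (intro poly_mapping_eqI) (auto simp: lookup_add lookup_minus lookup_single when_def)
    then have "weight n = weight m + r"
      using assms(1) by (simp add: weight_add)
    with n show ?thesis by force
  qed
  from weight_le_on_fst[OF _ this assms(2)] show ?thesis by simp
qed


subsection \<open>Intertwining formal series of operators\<close>

text \<open>\<open>Sum_any\<close> is 0 on an infinite support, and \<open>F\<close> may kill terms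
  and so turn an infinite support into a finite one. Finiteness is therefore required before
  \<open>F\<close> is applied.\<close>

lemma Sum_any_additive:
  assumes "Modules.additive F" "finite {k. g k \<noteq> 0}"
  shows "F (Sum_any g) = Sum_any (\<lambda>k. F (g k))"
proof -
  interpret Modules.additive F by fact
  have "Sum_any (\<lambda>k. F (g k)) = (\<Sum>k\<in>{k. g k \<noteq> 0}. F (g k))"
    using assms(2) by (rule Sum_any.expand_superset) (auto simp: zero)
  then show ?thesis by (simp add: Sum_any.expand_set sum)
qed

lemma ser_mult_intertwine:
  assumes "Modules.additive F"
    and "\<And>m w. F (a m w) = a' m (F w)" and "\<And>m w. F (b m w) = b' m (F w)"
    and "finite {k. a (n - k) (b k v) \<noteq> 0}"
  shows "F (ser_mult a b n v) = ser_mult a' b' n (F v)"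
  unfolding ser_mult_def by (simp add: Sum_any_additive[OF assms(1,4)] assms(2,3))

text \<open>
  A series without constant term whose exponents all have the sign \<open>\<sigma>\<close>. Then its \<open>n\<close>-th power
  starts in degree \<open>\<sigma> n\<close>, so that in each degree the exponential series is a finite sum.
\<close>

locale one_sided_series =
  fixes \<sigma> :: int and a :: "'i::finite op_series"
  assumes sigma: "\<sigma> = 1 \<or> \<sigma> = - 1"
    and one_sided: "\<sigma> * n \<le> 0 \<Longrightarrow> a n v = 0"
    and zero: "a n 0 = 0"
begin

lemma pow_zero: "ser_pow a n m 0 = 0"
  by (induction n arbitrary: m) (simp_all add: ser_const_def ser_mult_def zero)

lemma pow_support: "\<sigma> * m < int n \<Longrightarrow> ser_pow a n m v = 0"
proof (induction n arbitrary: m)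
  case 0
  then show ?case by (auto simp: ser_const_def)
next
  case (Suc n)
  \<comment> \<open>Either the inner power vanishes by induction, or \<open>\<sigma> * k\<close> is
    at least \<open>n\<close> and leaves no positive degree for the factor \<open>a\<close>.\<close>
  have "a (m - k) (ser_pow a n k v) = 0" for k
  proof (cases "\<sigma> * k < int n")
    case True
    then show ?thesis by (simp add: Suc.IH zero)
  next
    case False
    then have "\<sigma> * (m - k) \<le> 0" using Suc.prems sigma by auto
    then show ?thesis by (rule one_sided)
  qed
  then show ?case by (simp add: ser_mult_def)
qed

lemma finite_pow_Suc: "finite {k. a (m - k) (ser_pow a n k v) \<noteq> 0}"
proof (rule finite_subset)
  show "{k. a (m - k) (ser_pow a n k v) \<noteq> 0} \<subseteq> {- \<bar>m\<bar>..\<bar>m\<bar>}"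
  proof
    fix k
    assume "k \<in> {k. a (m - k) (ser_pow a n k v) \<noteq> 0}"
    \<comment> \<open>Together these say \<open>0 \<le> \<sigma> * k < \<sigma> * m\<close>.\<close>
    then have "\<not> \<sigma> * (m - k) \<le> 0" "\<not> \<sigma> * k < int n"
      using one_sided pow_support zero by auto
    then show "k \<in> {- \<bar>m\<bar>..\<bar>m\<bar>}" using sigma by auto
  qed
qed simp

lemma finite_exp: "finite {n. fscale (1 / fact n) (ser_pow a n m v) \<noteq> 0}"
proof (rule finite_subset)
  show "{n. fscale (1 / fact n) (ser_pow a n m v) \<noteq> 0} \<subseteq> {..nat \<bar>m\<bar>}"
  proof
    fix n
    assume "n \<in> {n. fscale (1 / fact n) (ser_pow a n m v) \<noteq> 0}"
    then have "\<not> \<sigma> * m < int n" using pow_support by auto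
    then show "n \<in> {..nat \<bar>m\<bar>}" using sigma by auto
  qed
qed simp

lemma exp_zero: "ser_exp a m 0 = 0"
  by (simp add: ser_exp_def pow_zero)

lemma exp_support: "\<sigma> * m < 0 \<Longrightarrow> ser_exp a m v = 0"
  by (simp add: ser_exp_def pow_support)

context
  fixes F :: "'i fock \<Rightarrow> 'i fock" and a' :: "'i op_series"
  assumes F: "Modules.additive F" "\<And>c v. F (fscale c v) = fscale c (F v)"
    and intertwine: "\<And>n v. F (a n v) = a' n (F v)"
begin

text \<open>No finiteness is asked of \<open>a'\<close>: at an argument \<open>F v\<close>, each sum
  on its side is the termwise image of a finite sum for \<open>a\<close>.\<close>

lemma pow_intertwine: "F (ser_pow a n m v) = ser_pow a' n m (F v)"
proof (induction n arbitrary: m v)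
  case 0
  show ?case by (simp add: ser_const_def Modules.additive.zero[OF F(1)])
next
  case (Suc n)
  then show ?case
    by (simp add: ser_mult_intertwine[where a' = a' and b' = "ser_pow a' n"] F(1) intertwine finite_pow_Suc)
qed

lemma exp_intertwine: "F (ser_exp a m v) = ser_exp a' m (F v)"
  unfolding ser_exp_def by (simp add: Sum_any_additive[OF F(1) finite_exp] F(2) pow_intertwine)

end

text \<open>The degree in \<open>z\<close> bounds the change of weight. Degrees add in products of
  series just as weight shifts add in compositions, so the bound passes to powers and to the
  exponential.\<close>

lemma weight_le_exp:
  assumes weight: "\<And>d n v. weight_le d v \<Longrightarrow> weight_le (d + n) (a n v)" and "weight_le d v"
  shows "weight_le (d + m) (ser_exp a m v)"
proof -
  have "weight_le (d + m) (ser_pow a n m v)" for n m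
  proof (induction n arbitrary: m)
    case 0
    with assms(2) show ?case by (simp add: ser_const_def)
  next
    case (Suc n)
    have "weight_le (d + m) (a (m - k) (ser_pow a n k v))" for k
      using weight[OF Suc[of k], of "m - k"] by simp
    then show ?case by (simp add: ser_mult_def weight_le_Sum_any)
  qed
  then show ?thesis by (simp add: ser_exp_def weight_le_Sum_any weight_le_fscale)
qed

end

text \<open>On a fixed vector, the factor from \<open>z_partial\<close> has finitely many nonzero
  coefficients, the lowering exponential vanishes in very negative degrees for weight reasons, and
  the raising one has no negative degrees. So all sums for the source operators are finite and
  \<open>F\<close> can be moved past them; of \<open>a'\<close> and \<open>b'\<close> only the
  intertwining is asked.\<close>

lemma vertex_series_intertwine:
  fixes F :: "'i::finite fock \<Rightarrow> 'i fock"
  assumes F: "Modules.additive F" "\<And>c v. F (fscale c v) = fscale c (F v)"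
    and F_e: "\<And>v. F (e_op \<epsilon> \<alpha> v) = e_op \<epsilon> \<alpha> (F v)"
    and F_z: "\<And>n v. F (z_partial A \<alpha> n v) = z_partial A \<alpha> n (F v)"
    and a: "\<And>r. a r 0 = 0" "\<And>r v. 0 < r \<Longrightarrow> F (a r v) = a' r (F v)"
    and b: "\<And>r. b r 0 = 0" "\<And>r v. 0 < r \<Longrightarrow> F (b r v) = b' r (F v)"
    and b_weight: "\<And>d r v. 0 < r \<Longrightarrow> weight_le d v \<Longrightarrow> weight_le (d - int r) (b r v)"
  shows "F (vertex_series A \<epsilon> a b \<alpha> n v) = vertex_series A \<epsilon> a' b' \<alpha> n (F v)"
proof -
  let ?pos = "\<lambda>a n v. if n > 0 then fscale (1 / of_int n) (a (nat n) v) else 0"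
  let ?neg = "\<lambda>b n v. if n < 0 then fscale (- 1 / of_int (- n)) (b (nat (- n)) v) else 0"
  let ?e = "ser_const (e_op \<epsilon> \<alpha>)" and ?z = "z_partial A \<alpha>"
  have F0: "F 0 = 0" by (rule Modules.additive.zero[OF F(1)])
  interpret pos: one_sided_series 1 "?pos a" by unfold_locales (simp_all add: a)
  interpret neg: one_sided_series "-1" "?neg b" by unfold_locales (simp_all add: b)
  define P P' N N' Z where PN_defs: "P = ser_exp (?pos a)" "P' = ser_exp (?pos a')"
    "N = ser_exp (?neg b)" "N' = ser_exp (?neg b')" "Z = ser_mult ?e ?z"
  have pos: "F (P m w) = P' m (F w)" for m w
    unfolding PN_defs by (rule pos.exp_intertwine[OF F]) (simp add: F a F0)
  have neg: "F (N m w) = N' m (F w)" for m w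
    unfolding PN_defs by (rule neg.exp_intertwine[OF F]) (simp add: F b F0)
  have neg_weight: "weight_le (d + m) (N m w)" if "weight_le d w" for d m w
    unfolding PN_defs
  proof (rule neg.weight_le_exp[OF _ that])
    fix d n and v :: "'i fock"
    assume "weight_le d v"
    then show "weight_le (d + n) (?neg b n v)"
      using b_weight[of "nat (- n)" d v] by (simp add: weight_le_fscale)
  qed
  have neg_vanish: "\<exists>d. \<forall>m<d. N m w = 0" for w
  proof -
    obtain d where "weight_le d w" using weight_le_exists by blast
    \<comment> \<open>For \<open>m < - d\<close> the weight bound \<open>d + m\<close> is negative,
      which leaves only the zero vector.\<close>
    from weight_le_neg_imp_0[OF neg_weight[OF this]] show ?thesis
      by (intro exI[of _ "- d"]) simp
  qed
  have ez: "Z k v = e_op \<epsilon> \<alpha> (?z k v)" for k v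
  proof -
    \<comment> \<open>The left factor is concentrated in degree 0, so only \<open>j = k\<close>
      survives.\<close>
    have "Z k v = Sum_any (\<lambda>j. if k = j then e_op \<epsilon> \<alpha> (?z j v) else 0)"
      unfolding PN_defs ser_mult_def by (rule Sum_any.cong) (simp add: ser_const_def)
    then show ?thesis by simp
  qed
  have F_ez: "F (Z k v) = Z k (F v)" for k v
    by (simp add: ez F_e F_z)
  have z_support: "?z k v = 0" if "k \<notin> form A \<alpha> ` Poly_Mapping.keys v" for k v
  proof (rule poly_mapping_eqI)
    fix \<beta>
    show "Poly_Mapping.lookup (?z k v) \<beta> = Poly_Mapping.lookup 0 \<beta>"
      using that by (auto simp: lookup_z_partial in_keys_iff)
  qed
  let ?G = "ser_mult N Z"
  have neg_ez: "N m (Z k v) = 0"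
    if "k \<notin> form A \<alpha> ` Poly_Mapping.keys v" for m k v
    using neg.exp_zero[folded PN_defs] by (simp add: ez z_support[OF that])
  have G_finite: "finite {k. N (m - k) (Z k v) \<noteq> 0}" for m v
  proof (rule finite_subset)
    show "{k. N (m - k) (Z k v) \<noteq> 0} \<subseteq> form A \<alpha> ` Poly_Mapping.keys v"
      using neg_ez by blast
  qed simp
  have F_G: "F (?G k v) = ser_mult N' Z k (F v)" for k v
    by (rule ser_mult_intertwine[where F = F and a = N and b = Z, OF F(1) neg F_ez G_finite])
  have G_vanish: "\<exists>d. \<forall>k<d. ?G k v = 0"
  proof -
    have "\<forall>k. \<exists>d. \<forall>m<d. N m (Z k v) = 0" using neg_vanish by blast
    from choice[OF this] obtain d where d: "\<And>k m. m < d k \<Longrightarrow> N m (Z k v) = 0" by blast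
    \<comment> \<open>The product in degree \<open>k\<close> involves \<open>N (k - j)\<close>,
      which vanishes on \<open>Z j v\<close> for \<open>k < d j + j\<close>. Only the finitely many
      \<open>j\<close> in the image of the support matter, so a minimum gives a uniform bound;
      \<open>insert 0\<close> keeps the set nonempty for \<open>v = 0\<close>.\<close>
    let ?D = "insert 0 ((\<lambda>j. d j + j) ` form A \<alpha> ` Poly_Mapping.keys v)"
    have "N (k - j) (Z j v) = 0" if "k < Min ?D" for k j
    proof (cases "j \<in> form A \<alpha> ` Poly_Mapping.keys v")
      case True
      then have "d j + j \<in> ?D" by blast
      then have "Min ?D \<le> d j + j" by (intro Min_le) auto
      with that have "k - j < d j" by linarith
      then show ?thesis by (rule d)
    next
      case False
      then show ?thesis by (rule neg_ez)
    qed
    then show ?thesis by (intro exI[of _ "Min ?D"]) (simp add: ser_mult_def)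
  qed
  then obtain d where d: "\<And>k. k < d \<Longrightarrow> ?G k v = 0" by blast
  have "finite {k. P (n - k) (?G k v) \<noteq> 0}"
  proof (rule finite_subset)
    \<comment> \<open>The lower bound comes from \<open>?G\<close>, the upper one from
      \<open>P\<close> having no negative degrees.\<close>
    show "{k. P (n - k) (?G k v) \<noteq> 0} \<subseteq> {d..n}"
    proof
      fix k
      assume k: "k \<in> {k. P (n - k) (?G k v) \<noteq> 0}"
      then have "\<not> k < d" using d[of k] pos.exp_zero[folded PN_defs] by auto
      moreover have "\<not> n - k < 0" using k pos.exp_support[folded PN_defs] by auto
      ultimately show "k \<in> {d..n}" by simp
    qed
  qed simp
  then show ?thesis
    unfolding vertex_series_def PN_defs[symmetric]
    by (rule ser_mult_intertwine[where F = F and a = P and b = "ser_mult N Z", OF F(1) pos F_G])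
qed


subsection \<open>Modules over presented Lie algebras\<close>

text \<open>Zero is its own bracket with itself, and such a bracket acts as the commutator of an
  operator with itself.\<close>

lemma lie_module_LZero:
  assumes "lie_module R sc \<rho>"
  shows "\<rho> (lie_class R LZero) v = 0"
proof -
  have "lie_class R LZero = cls_br R (lie_class R LZero) (lie_class R LZero)"
    by (simp add: cls_br_class lie_class_eq_iff lc_sym[OF lc_br_self])
  moreover have "lie_class R LZero \<in> lie_carrier R" by (auto simp: lie_carrier_def)
  ultimately show ?thesis using assms by (metis diff_self lie_module_def)
qed

lemma lie_module_class:
  assumes "lie_module R sc \<rho>"
  shows "\<rho> (lie_class R (LAdd x y)) v = \<rho> (lie_class R x) v + \<rho> (lie_class R y) v"
    and "\<rho> (lie_class R (LScale c x)) v = sc c (\<rho> (lie_class R x) v)"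
    and "\<rho> (lie_class R (LBr x y)) v =
      \<rho> (lie_class R x) (\<rho> (lie_class R y) v) - \<rho> (lie_class R y) (\<rho> (lie_class R x) v)"
proof -
  have "lie_class R t \<in> lie_carrier R" for t by (auto simp: lie_carrier_def)
  with assms show "\<rho> (lie_class R (LAdd x y)) v = \<rho> (lie_class R x) v + \<rho> (lie_class R y) v"
    "\<rho> (lie_class R (LScale c x)) v = sc c (\<rho> (lie_class R x) v)"
    "\<rho> (lie_class R (LBr x y)) v =
      \<rho> (lie_class R x) (\<rho> (lie_class R y) v) - \<rho> (lie_class R y) (\<rho> (lie_class R x) v)"
    by (simp_all add: lie_module_def flip: cls_add_class cls_scale_class cls_br_class)
qed

text \<open>Every element of the presented algebra is the class of a term, so structural induction
  on terms reduces the claim to generators.\<close>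

lemma lie_module_hom_of_generators:
  assumes \<rho>: "lie_module R sc \<rho>" and \<rho>': "lie_module R sc' \<rho>'"
    and f: "Vector_Spaces.linear sc sc' f"
    and gen: "\<And>g v. f (\<rho> (lie_class R (Gen g)) v) = \<rho>' (lie_class R (Gen g)) (f v)"
  shows "lie_module_hom R sc \<rho> sc' \<rho>' f"
proof -
  interpret f: Vector_Spaces.linear sc sc' f by fact
  have "f (\<rho> (lie_class R t) v) = \<rho>' (lie_class R t) (f v)" for t v
    by (induction t arbitrary: v)
      (simp_all add: gen lie_module_LZero[OF \<rho>] lie_module_LZero[OF \<rho>'] lie_module_class[OF \<rho>]
        lie_module_class[OF \<rho>'] f.add f.diff f.scale f.zero)
  with f show ?thesis by (auto simp: lie_module_hom_def lie_carrier_def)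
qed

lemma linear_inverse:
  assumes f: "Vector_Spaces.linear sc sc' f" and "f \<circ> g = id" "g \<circ> f = id"
  shows "Vector_Spaces.linear sc' sc g"
proof -
  have fg: "f (g y) = y" and gf: "g (f x) = x" for x y
    using assms(2,3) by (simp_all add: fun_eq_iff)
  have "g (y + z) = g y + g z" "g (sc' c y) = sc c (g y)" for c y z
    using f fg gf unfolding Vector_Spaces.linear_iff by metis+
  with f show ?thesis unfolding Vector_Spaces.linear_iff by blast
qed

lemma lie_module_hom_inverse:
  assumes f: "lie_module_hom R sc \<rho> sc' \<rho>' f" and "f \<circ> g = id" "g \<circ> f = id"
  shows "lie_module_hom R sc' \<rho>' sc \<rho> g"
proof -
  have fg: "f (g y) = y" and gf: "g (f x) = x" for x y
    using assms(2,3) by (simp_all add: fun_eq_iff)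
  have "g (\<rho>' X w) = \<rho> X (g w)" if "X \<in> lie_carrier R" for X w
    using f that fg gf unfolding lie_module_hom_def by metis
  with f linear_inverse[OF _ assms(2,3)] show ?thesis unfolding lie_module_hom_def by blast
qed

text \<open>The relation \<open>XX_opp\<close> with \<open>i = j\<close> and \<open>l = 0\<close>,
  solved for \<open>HG i k\<close>. Since \<open>is_module_V\<close> prescribes only the action of
  the \<open>XG\<close> and of \<open>CG\<close>, this is how the action of \<open>HG\<close> on
  that module is accessed.\<close>

lemma t_module_H:
  assumes "lie_module (t_rels A) fscale \<rho>"
  shows "\<rho> (t_gen_class A (HG i k)) v =
    \<rho> (t_gen_class A (XG Pos i k)) (\<rho> (t_gen_class A (XG Neg i 0)) v)
    - \<rho> (t_gen_class A (XG Neg i 0)) (\<rho> (t_gen_class A (XG Pos i k)) v)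
    - fscale (of_int (- delta_z k 0)) (\<rho> (t_gen_class A CG) v)"
proof -
  have "lie_class (t_rels A) (LBr (Gen (XG Pos i k)) (Gen (XG Neg i 0))) =
      lie_class (t_rels A) (LAdd (Gen (HG i k)) (LScale (of_int (- delta_z k 0)) (Gen CG)))"
    unfolding lie_class_eq_iff using t_rels.XX_opp[of i k i 0 A] by (intro lc_rel) simp
  then show ?thesis
    using lie_module_class[OF assms] by (metis add_diff_cancel_right')
qed


subsection \<open>Linear substitutions\<close>

text \<open>The same matrix acts at every level \<open>n\<close>. Its entries are complex so that
  the inverse of an integer matrix is also covered.\<close>

definition lin_subst :: "complex ^ 'i::finite ^ 'i \<Rightarrow> 'i hpoly \<Rightarrow> 'i hpoly" where
  "lin_subst M = poly_subst (\<lambda>(i, n). \<Sum>j\<in>UNIV. Const (M $ i $ j) * Var (j, n))"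

lemma lin_subst_add: "lin_subst M (p + q) = lin_subst M p + lin_subst M q"
  and lin_subst_mult: "lin_subst M (p * q) = lin_subst M p * lin_subst M q"
  and lin_subst_Const: "lin_subst M (Const c) = Const c"
  and lin_subst_0 [simp]: "lin_subst M 0 = 0"
  and lin_subst_Var: "lin_subst M (Var (i, n)) = (\<Sum>j\<in>UNIV. Const (M $ i $ j) * Var (j, n))"
  by (simp_all add: lin_subst_def poly_subst_add poly_subst_mult)

lemma lin_subst_sum: "lin_subst M (\<Sum>i\<in>I. f i) = (\<Sum>i\<in>I. lin_subst M (f i))"
  by (simp add: lin_subst_def poly_subst_sum)

text \<open>The factors appear in reverse order: row \<open>i\<close> of the inner matrix
  \<open>N\<close> expands the image of a variable, and \<open>M\<close> then expands the variables
  in it.\<close>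

lemma lin_subst_lin_subst: "lin_subst M (lin_subst N p) = lin_subst (N ** M) p"
proof -
  have "lin_subst M (\<Sum>j\<in>UNIV. Const (N $ i $ j) * Var (j, n)) =
      (\<Sum>k\<in>UNIV. Const ((N ** M) $ i $ k) * Var (k, n))" for i n
  proof -
    have "lin_subst M (\<Sum>j\<in>UNIV. Const (N $ i $ j) * Var (j, n)) =
        (\<Sum>j\<in>UNIV. \<Sum>k\<in>UNIV. Const (N $ i $ j) * (Const (M $ j $ k) * Var (k, n)))"
      by (simp add: lin_subst_sum lin_subst_mult lin_subst_Const lin_subst_Var sum_distrib_left)
    also have "\<dots> = (\<Sum>k\<in>UNIV. Const ((N ** M) $ i $ k) * Var (k, n))"
      by (subst sum.swap)
        (simp add: matrix_matrix_mult_def Const_sum Const_mult sum_distrib_right mult.assoc)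
    finally show ?thesis .
  qed
  then have "(\<lambda>x. lin_subst M (case x of (i, n) \<Rightarrow> \<Sum>j\<in>UNIV. Const (N $ i $ j) * Var (j, n))) =
      (\<lambda>(i, n). \<Sum>k\<in>UNIV. Const ((N ** M) $ i $ k) * Var (k, n))"
    by (simp add: fun_eq_iff)
  then show ?thesis
    unfolding lin_subst_def poly_subst_poly_subst by simp
qed

lemma lin_subst_mat_1: "lin_subst (mat 1) p = p"
  for p :: "'i::finite hpoly"
proof -
  let ?I = "mat 1 :: complex ^ 'i ^ 'i"
  have "(\<Sum>j\<in>UNIV. Const (?I $ i $ j) * Var (j, n)) = Var (i, n)" for i and n :: nat
  proof -
    have "(\<Sum>j\<in>UNIV. Const (?I $ i $ j) * Var (j, n)) =
        (\<Sum>j\<in>UNIV. if j = i then Var (j, n) else 0)"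
      by (intro sum.cong) (simp_all add: mat_def)
    then show ?thesis by simp
  qed
  then have "(\<lambda>(i, n :: nat). \<Sum>j\<in>UNIV. Const (?I $ i $ j) * Var (j, n)) = Var"
    by (simp add: fun_eq_iff)
  then show ?thesis by (simp add: lin_subst_def poly_subst_Var_id)
qed

text \<open>The chain rule for the finite set of variables at level \<open>n\<close>. The
  substitution preserves levels, so no other variable has an image containing
  \<open>(i, n)\<close>.\<close>

lemma partial_deriv_lin_subst:
  "partial_deriv (i, n) (lin_subst M p) =
    (\<Sum>j\<in>UNIV. Const (M $ j $ i) * lin_subst M (partial_deriv (j, n) p))"
  for M :: "complex ^ 'i::finite ^ 'i"
proof -
  let ?s = "\<lambda>(j, k). \<Sum>l\<in>UNIV. Const (M $ j $ l) * Var (l, k) :: 'i hpoly"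
  have deriv: "partial_deriv (i, n) (\<Sum>l\<in>UNIV. Const (M $ j $ l) * Var (l, k)) =
      (if k = n then Const (M $ j $ i) else 0)" for j k
    by (cases "k = n") (simp_all add: partial_deriv_sum partial_deriv_mult partial_deriv_Var
        if_distrib[of "(*) _"] cong: if_cong)
  have "partial_deriv (i, n) (poly_subst ?s p) =
      (\<Sum>x\<in>(\<lambda>j. (j, n)) ` UNIV. partial_deriv (i, n) (?s x) * poly_subst ?s (partial_deriv x p))"
  proof (rule partial_deriv_poly_subst)
    fix x :: "'i \<times> nat"
    assume "x \<notin> range (\<lambda>j. (j, n))"
    then show "partial_deriv (i, n) (?s x) = 0"
      by (cases x) (auto simp: deriv)
  qed simp
  also have "\<dots> = (\<Sum>j\<in>UNIV. Const (M $ j $ i) * poly_subst ?s (partial_deriv (j, n) p))"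
    by (subst sum.reindex) (simp_all add: inj_on_def deriv)
  finally show ?thesis by (simp add: lin_subst_def)
qed

lemma lookup_linear_form:
  fixes c :: "'i::finite \<Rightarrow> complex"
  shows
  "Poly_Mapping.lookup (\<Sum>j\<in>UNIV. Const (c j) * Var (j, n)) (Poly_Mapping.single (i, n) 1) = c i"
proof -
  have "Poly_Mapping.lookup (\<Sum>j\<in>UNIV. Const (c j) * Var (j, n)) (Poly_Mapping.single (i, n) 1) =
      (\<Sum>j\<in>UNIV. if j = i then c j else 0)"
    unfolding lookup_sum
  proof (rule sum.cong[OF refl])
    fix j
    have "Poly_Mapping.single (j, n) (1::nat) = Poly_Mapping.single (i, n) 1 \<longleftrightarrow> j = i"
      by (metis lookup_single_eq lookup_single_not_eq one_neq_zero prod.inject)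
    then show "Poly_Mapping.lookup (Const (c j) * Var (j, n)) (Poly_Mapping.single (i, n) 1) =
        (if j = i then c j else 0)"
      by (simp add: Const_def Var_def mult_single lookup_single when_def)
  qed
  then show ?thesis by simp
qed

lemma inj_lin_subst_imp_invertible:
  fixes M :: "complex ^ 'i::finite ^ 'i"
  assumes "inj (on_fst (lin_subst M))"
  shows "invertible M"
proof -
  have "x = 0" if x: "transpose M *v x = 0" for x
  proof -
    \<comment> \<open>Level 0 is an arbitrary choice; the image of this linear form has coefficient
      vector \<open>transpose M *v x\<close>.\<close>
    let ?p = "\<Sum>i\<in>UNIV. Const (x $ i) * Var (i, 0) :: 'i hpoly"
    have "lin_subst M ?p = (\<Sum>i\<in>UNIV. \<Sum>j\<in>UNIV. Const (x $ i) * (Const (M $ i $ j) * Var (j, 0)))"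
      by (simp add: lin_subst_sum lin_subst_mult lin_subst_Const lin_subst_Var sum_distrib_left)
    also have "\<dots> = (\<Sum>j\<in>UNIV. Const ((transpose M *v x) $ j) * Var (j, 0))"
      by (subst sum.swap)
        (simp add: matrix_vector_mult_def transpose_def Const_sum Const_mult sum_distrib_left
          sum_distrib_right mult_ac)
    finally have "lin_subst M ?p = 0" unfolding x by simp
    then have "on_fst (lin_subst M) (Poly_Mapping.single 0 ?p) = on_fst (lin_subst M) 0"
      by (simp add: on_fst_single)
    with assms have "Poly_Mapping.single (0 :: int ^ 'i) ?p = 0" by (rule injD)
    then have "Poly_Mapping.lookup (Poly_Mapping.single (0 :: int ^ 'i) ?p) 0 = 0" by simp
    then have p: "?p = 0" by (simp only: lookup_single_eq)
    have "x $ i = Poly_Mapping.lookup ?p (Poly_Mapping.single (i, 0) 1)" for i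
      by (rule lookup_linear_form[symmetric])
    then show ?thesis unfolding p by (simp add: vec_eq_iff)
  qed
  then show ?thesis
    \<comment> \<open>A trivial kernel gives \<open>transpose M\<close> a left inverse, hence
      \<open>M\<close> a right inverse, which suffices for a square matrix.\<close>
    unfolding invertible_right_inverse left_invertible_transpose[symmetric] matrix_left_invertible_ker
    by blast
qed

lemma falgebra_hom_lin_subst: "falgebra_hom \<epsilon> (on_fst (lin_subst M))"
  by (intro falgebra_hom_on_fst lin_subst_add lin_subst_mult lin_subst_Const)


subsection \<open>The map \<open>\<Phi>\<^sub>A \<otimes> id\<close>\<close>

lemma form_simple_root: "form A (simple_root i) (simple_root j) = A $ i $ j"
proof -
  have "form A (simple_root i) (simple_root j) = (\<Sum>k\<in>UNIV. \<Sum>l\<in>UNIV. if l = j then if k = i then A $ k $ l else 0 else 0)"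
    unfolding form_def by (intro sum.cong) (simp_all add: simple_root_def axis_def)
  then show ?thesis by simp
qed

lemma Phi_eq_lin_subst: "Phi A = lin_subst (map_matrix complex_of_int A)"
  by (simp add: Phi_def lin_subst_def form_simple_root hvar_def map_matrix_def)

lemma Phi_id_eq: "Phi_id A = on_fst (lin_subst (map_matrix complex_of_int A))"
  by (simp add: Phi_id_def Phi_eq_lin_subst)

lemma linear_Phi_id: "Vector_Spaces.linear fscale fscale (Phi_id A)"
  unfolding Phi_id_eq by (intro linear_on_fst lin_subst_add lin_subst_mult lin_subst_Const)

lemma H_lin_simple_root:
  "H_lin A (simple_root i) k v = H_op A i k v"
  "H_lin A (- simple_root i) k v = - H_op A i k v"
proof -
  have "H_lin A (simple_root i) k v = (\<Sum>j\<in>UNIV. if j = i then H_op A j k v else 0)"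
    unfolding H_lin_def by (intro sum.cong) (simp_all add: simple_root_def axis_def)
  then show "H_lin A (simple_root i) k v = H_op A i k v" by simp
  have "H_lin A (- simple_root i) k v = (\<Sum>j\<in>UNIV. if j = i then - H_op A j k v else 0)"
    unfolding H_lin_def by (intro sum.cong) (simp_all add: simple_root_def axis_def)
  then show "H_lin A (- simple_root i) k v = - H_op A i k v" by simp
qed

lemma Phi_id_H_neg:
  assumes "0 < r"
  shows "Phi_id A (H_op A i (- int r) v) = cH_tilde_neg A i r (Phi_id A v)"
proof (rule poly_mapping_eqI)
  fix \<beta>
  show "Poly_Mapping.lookup (Phi_id A (H_op A i (- int r) v)) \<beta> =
      Poly_Mapping.lookup (cH_tilde_neg A i r (Phi_id A v)) \<beta>"
    using assms
    by (simp add: Phi_id_eq H_op_def cH_tilde_neg_def cH_neg_def lookup_sum lookup_fscale lookup_on_fst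
        form_simple_root hvar_def lin_subst_mult lin_subst_Var sum_distrib_right mult.assoc map_matrix_def)
qed

text \<open>The chain rule produces column \<open>i\<close> of \<open>A\<close>, whose entries are
  the coefficients in \<open>H_deriv A i r\<close>.\<close>

lemma Phi_id_H_pos:
  assumes "0 < r"
  shows "Phi_id A (H_op A i (int r) v) = cH_pos i r (Phi_id A v)"
proof (rule poly_mapping_eqI)
  fix \<beta>
  have "H_deriv A i r 0 = 0" by (simp add: H_deriv_def)
  with assms show "Poly_Mapping.lookup (Phi_id A (H_op A i (int r) v)) \<beta> =
      Poly_Mapping.lookup (cH_pos i r (Phi_id A v)) \<beta>"
    by (simp add: Phi_id_eq H_op_def cH_pos_def lookup_on_fst H_deriv_def lin_subst_sum lin_subst_mult
        lin_subst_Const partial_deriv_lin_subst form_simple_root Const_mult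
        sum_distrib_left mult.assoc map_matrix_def flip: Const_of_nat)
qed

lemma H_op_0 [simp]: "H_op A i k 0 = 0"
proof -
  have "H_deriv A i r 0 = 0" for r by (simp add: H_deriv_def)
  then show ?thesis
    by (intro poly_mapping_eqI) (simp add: H_op_def lookup_mapp)
qed

lemma weight_le_H_op:
  assumes "0 < r" "weight_le d v"
  shows "weight_le (d - int r) (H_op A i (int r) v)"
proof -
  have eq: "H_op A i (int r) v =
      (\<Sum>j\<in>UNIV. fscale (of_nat r * of_int (form A (simple_root j) (simple_root i)))
        (on_fst (partial_deriv (j, r - 1)) v))"
  proof (rule poly_mapping_eqI)
    fix \<beta>
    have "H_deriv A i r 0 = 0" by (simp add: H_deriv_def)
    with assms(1) show "Poly_Mapping.lookup (H_op A i (int r) v) \<beta> = Poly_Mapping.lookup (\<Sum>j\<in>UNIV.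
        fscale (of_nat r * of_int (form A (simple_root j) (simple_root i)))
          (on_fst (partial_deriv (j, r - 1)) v)) \<beta>"
      by (simp add: H_op_def lookup_on_fst lookup_sum lookup_fscale H_deriv_def)
  qed
  show ?thesis
    unfolding eq using assms by (intro weight_le_sum weight_le_fscale weight_le_partial_deriv)
qed

lemma Phi_id_X_series:
  "Phi_id A (fscale (of_int (sgn_int s)) (X_series A \<epsilon> (if s = Pos then simple_root i else - simple_root i) n v)) =
    cX_series A \<epsilon> s i n (Phi_id A v)"
proof -
  let ?\<alpha> = "if s = Pos then simple_root i else - simple_root i"
  \<comment> \<open>The sign of the root becomes the scalar inside the exponentials of
    \<open>cX_series\<close>, so both signs are treated at once.\<close>
  have H_lin: "H_lin A ?\<alpha> k w = fscale (of_int (sgn_int s)) (H_op A i k w)" for k w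
    by (cases s) (simp_all add: H_lin_simple_root)
  interpret Phi: Vector_Spaces.linear fscale fscale "Phi_id A" by (rule linear_Phi_id)
  have "Modules.additive (Phi_id A)" by unfold_locales (rule Phi.add)
  then have "Phi_id A (X_series A \<epsilon> ?\<alpha> n v) = vertex_series A \<epsilon>
      (\<lambda>r w. fscale (of_int (sgn_int s)) (cH_tilde_neg A i r w))
      (\<lambda>r w. fscale (of_int (sgn_int s)) (cH_pos i r w)) ?\<alpha> n (Phi_id A v)"
    unfolding X_series_def
  proof (rule vertex_series_intertwine)
    show "Phi_id A (e_op \<epsilon> ?\<alpha> w) = e_op \<epsilon> ?\<alpha> (Phi_id A w)" for w
      unfolding Phi_id_eq by (intro on_fst_e_op lin_subst_add lin_subst_mult lin_subst_Const)
    show "Phi_id A (z_partial A ?\<alpha> m w) = z_partial A ?\<alpha> m (Phi_id A w)" for m w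
      unfolding Phi_id_eq by (intro on_fst_z_partial lin_subst_0)
    show "weight_le (d - int r) (H_lin A ?\<alpha> (int r) w)" if "0 < r" "weight_le d w" for d r w
      unfolding H_lin using that by (intro weight_le_fscale weight_le_H_op)
  qed (simp_all only: H_lin Phi.scale Phi_id_H_neg Phi_id_H_pos H_op_0 fscale_0_right)
  then show ?thesis by (simp only: Phi.scale cX_series_def)
qed

section \<open>The module morphism and its invertibility\<close>

lemma lie_module_hom_Phi_id:
  assumes \<rho>A: "is_module_VA A \<epsilon> \<rho>A" and \<rho>: "is_module_V A \<epsilon> \<rho>"
  shows "lie_module_hom (t_rels A) fscale \<rho>A fscale \<rho> (Phi_id A)"
proof (rule lie_module_hom_of_generators)
  note VA = \<rho>A[unfolded is_module_VA_def] and V = \<rho>[unfolded is_module_V_def]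
  show mA: "lie_module (t_rels A) fscale \<rho>A" and m: "lie_module (t_rels A) fscale \<rho>"
    using VA V by blast+
  show lin: "Vector_Spaces.linear fscale fscale (Phi_id A)" by (rule linear_Phi_id)
  interpret Phi: Vector_Spaces.linear fscale fscale "Phi_id A" by (rule lin)
  have C: "Phi_id A (\<rho>A (t_gen_class A CG) v) = \<rho> (t_gen_class A CG) (Phi_id A v)" for v
  proof -
    have "\<rho>A (t_gen_class A CG) v = v" "\<rho> (t_gen_class A CG) (Phi_id A v) = Phi_id A v"
      using VA V by blast+
    then show ?thesis by simp
  qed
  have X: "Phi_id A (\<rho>A (t_gen_class A (XG s i k)) v) = \<rho> (t_gen_class A (XG s i k)) (Phi_id A v)"
    for s i k v
  proof -
    have "\<rho>A (t_gen_class A (XG Pos i k)) v = X_series A \<epsilon> (simple_root i) (- k - 1) v"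
      "\<rho>A (t_gen_class A (XG Neg i k)) v = - X_series A \<epsilon> (- simple_root i) (- k - 1) v"
      using VA by blast+
    then have "\<rho>A (t_gen_class A (XG s i k)) v = fscale (of_int (sgn_int s))
        (X_series A \<epsilon> (if s = Pos then simple_root i else - simple_root i) (- k - 1) v)"
      by (cases s) (simp_all only: sgn_int.simps sign_pm.distinct if_True if_False of_int_1
          of_int_minus fscale_1 fscale_minus1 simp_thms)
    moreover have "\<rho> (t_gen_class A (XG s i k)) (Phi_id A v) = cX_series A \<epsilon> s i (- k - 1) (Phi_id A v)"
      using V by blast
    ultimately show ?thesis by (simp only: Phi_id_X_series)
  qed
  show "Phi_id A (\<rho>A (t_gen_class A g) v) = \<rho> (t_gen_class A g) (Phi_id A v)" for g v
    \<comment> \<open>For \<open>HG\<close>, both actions are rewritten by \<open>t_module_H\<close>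
      in terms of \<open>XG\<close> and \<open>CG\<close>.\<close>
    by (cases g) (simp_all only: C X t_module_H[OF mA] t_module_H[OF m] Phi.diff Phi.scale)
qed

text \<open>One inverse serves both structures: it is an algebra morphism as a substitution, and a
  module morphism as the inverse of one.\<close>

lemma falgebra_iso_Phi_id:
  assumes "invertible (map_matrix complex_of_int A)"
  obtains g where "falgebra_hom \<epsilon> g" "g \<circ> Phi_id A = id" "Phi_id A \<circ> g = id"
proof -
  obtain B where B: "map_matrix complex_of_int A ** B = mat 1" "B ** map_matrix complex_of_int A = mat 1"
    using assms unfolding invertible_def by blast
  have "on_fst (lin_subst (mat 1)) v = v" for v :: "'a fock"
    by (intro poly_mapping_eqI) (simp add: lookup_on_fst lin_subst_mat_1)
  with B have "on_fst (lin_subst B) \<circ> Phi_id A = id" "Phi_id A \<circ> on_fst (lin_subst B) = id"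
    by (simp_all add: fun_eq_iff Phi_id_eq on_fst_on_fst lin_subst_lin_subst)
  with falgebra_hom_lin_subst show ?thesis by (rule that)
qed

text \<open>Only injectivity is extracted from \<open>g\<close>, so the lemma applies to
  isomorphisms of algebras and of modules alike.\<close>

lemma inj_Phi_id_imp_invertible:
  assumes "g \<circ> Phi_id A = id"
  shows "invertible (map_matrix complex_of_int A)"
proof (rule inj_lin_subst_imp_invertible)
  show "inj (on_fst (lin_subst (map_matrix complex_of_int A)))"
    using assms by (metis Phi_id_eq inj_on_id inj_on_imageI2)
qed

theorem proposition5p17:
  fixes A :: "int ^ 'i::finite ^ 'i"
    and \<epsilon> :: "int ^ 'i \<Rightarrow> int ^ 'i \<Rightarrow> complex"
    and \<rho>A \<rho> :: "'i t_gen lie_term set \<Rightarrow> 'i fock \<Rightarrow> 'i fock"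
  assumes "simply_laced_indecomposable A"
    and "cocycle A \<epsilon>"
    and "is_module_VA A \<epsilon> \<rho>A"
    and "is_module_V A \<epsilon> \<rho>"
  shows "falgebra_hom \<epsilon> (Phi_id A)
    \<and> lie_module_hom (t_rels A) fscale \<rho>A fscale \<rho> (Phi_id A)
    \<and> (lie_module_iso (t_rels A) fscale \<rho>A fscale \<rho> (Phi_id A)
         \<longleftrightarrow> invertible (map_matrix complex_of_int A))
    \<and> (falgebra_iso \<epsilon> (Phi_id A) \<longleftrightarrow> invertible (map_matrix complex_of_int A))"
proof (intro conjI iffI)
  show alg: "falgebra_hom \<epsilon> (Phi_id A)"
    unfolding Phi_id_eq by (rule falgebra_hom_lin_subst)
  show lie: "lie_module_hom (t_rels A) fscale \<rho>A fscale \<rho> (Phi_id A)"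
    using assms(3,4) by (rule lie_module_hom_Phi_id)
  show "invertible (map_matrix complex_of_int A)" if "lie_module_iso (t_rels A) fscale \<rho>A fscale \<rho> (Phi_id A)"
    using that inj_Phi_id_imp_invertible unfolding lie_module_iso_def by blast
  show "invertible (map_matrix complex_of_int A)" if "falgebra_iso \<epsilon> (Phi_id A)"
    using that inj_Phi_id_imp_invertible unfolding falgebra_iso_def by blast
  assume inv: "invertible (map_matrix complex_of_int A)"
  show "falgebra_iso \<epsilon> (Phi_id A)"
    using falgebra_iso_Phi_id[OF inv] alg unfolding falgebra_iso_def by metis
  obtain g where "g \<circ> Phi_id A = id" "Phi_id A \<circ> g = id"
    using falgebra_iso_Phi_id[OF inv] by metis
  with lie show "lie_module_iso (t_rels A) fscale \<rho>A fscale \<rho> (Phi_id A)"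
    using lie_module_hom_inverse[OF lie] unfolding lie_module_iso_def by blast
qed

end
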